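(* Let $G$ be an infinite bireversible group. Then there exists a connected, locally finite graph $X$ on which $G$ acts faithfully and geometrically such that, for some vertex $x$ of $X$, $\mathrm{Comm}_{\mathrm{Aut}(X)}(G)\cap\mathrm{Aut}_x(X)$ contains a finitely generated subgroup that is not discrete. Consequently, $\mathrm{Aut}(X)$ is not compact-by-discrete.
   Context: Graphs may have multiple edges and loops. $\mathrm{Aut}(X)$ is the group of automorphisms of $X$ with its natural totally disconnected locally compact topology (pointwise convergence on vertices and edges), $\mathrm{Aut}_x(X)$ is the stabiliser of the vertex $x$, and $G$ is identified with its image in $\mathrm{Aut}(X)$ under the faithful action. The action is geometric if it is properly discontinuous and cocompact, by isometries, on $X$ seen as a 1-dimensional CW-complex. For $H\leq K$, $\mathrm{Comm}_K(H)=\{k\in K\mid [H:H\cap kHk^{-1}]<\infty,\ [kHk^{-1}:H\cap kHk^{-1}]<\infty\}$. A topological group $\Gamma$ is compact-by-discrete if there is a compact normal subgroup $N$ such that $\Gamma/N$ with the quotient topology is discrete. Bireversible groups. A Mealy automaton is a tuple $\mathcal{M}=(A,Q,\lambda,\rho)$ where $A$ (alphabet) and $Q$ (state set) are finite sets and $\lambda\colon Q\times A\to A$, $\rho\colon Q\times A\to Q$ are maps. It is invertible if $\lambda_q\colon A\to A$, $a\mapsto\lambda(q,a)$ is a bijection for every $q\in Q$; reversible if $\rho_a\colon Q\to Q$, $q\mapsto \rho(q,a)$ is a bijection for every $a\in A$; bireversible if it is invertible, reversible and $Q\times A\to A\times Q$, $(q,a)\mapsto(\lambda(q,a),\rho(q,a))$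 is a bijection. Let $A^*$ be the free monoid on $A$. Each $\lambda_q$ extends to $A^*$ by $\lambda_q(aw)=\lambda_q(a)\lambda_{\rho(q,a)}(w)$. If $\mathcal{M}$ is invertible, these are bijections of $A^*$, giving a homomorphism $f_Q$ from the free group $F_Q$ to the group of bijections of $A^*$ (acting on the left), and the group generated by $\mathcal{M}$ is $G_{\mathcal{M}}=F_Q/\ker(f_Q)$. A group is called bireversible if it is isomorphic to $G_{\mathcal{M}}$ for some bireversible automaton $\mathcal{M}$. *)

theory Defs
  imports
    "HOL-Analysis.Analysis"
    "HOL-Algebra.Generated_Groups"
    "HOL-Algebra.Group_Action"
    "Graph_Theory.Bidirected_Digraph"
    "Graph_Theory.Digraph_Component"
begin

section \<open>Free groups\<close>

text \<open>
  Letters are pairs \<open>(q, b)\<close>, standing for \<open>q\<close> if \<open>b\<close> and for the inverse of \<open>q\<close> otherwise.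
  Elements of the free group are the reduced words; \<open>free_cons\<close> multiplies a reduced word
  by a letter from the left.
\<close>

definition flip :: "'q \<times> bool \<Rightarrow> 'q \<times> bool" where
  "flip x = (fst x, \<not> snd x)"

definition reduced_word :: "('q \<times> bool) list \<Rightarrow> bool" where
  "reduced_word w \<longleftrightarrow> successively (\<lambda>x y. y \<noteq> flip x) w"

definition free_cons :: "'q \<times> bool \<Rightarrow> ('q \<times> bool) list \<Rightarrow> ('q \<times> bool) list" where
  "free_cons x w = (case w of [] \<Rightarrow> [x] | y # w' \<Rightarrow> if y = flip x then w' else x # w)"

definition free_group :: "'q set \<Rightarrow> ('q \<times> bool) list monoid" where
  "free_group Q =
     \<lparr>carrier = {w. fst ` set w \<subseteq> Q \<and> reduced_word w},
      mult = \<lambda>u v. foldr free_cons u v,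
      one = []\<rparr>"

lemma flip_flip [simp]: "flip (flip x) = x"
  by (simp add: flip_def)

lemma fst_flip [simp]: "fst (flip x) = fst x"
  by (simp add: flip_def)

lemma free_cons_closed:
  assumes "fst x \<in> Q" "w \<in> carrier (free_group Q)"
  shows "free_cons x w \<in> carrier (free_group Q)"
  using assms
  by (cases w) (auto simp: free_group_def free_cons_def reduced_word_def successively_Cons)

lemma free_cons_flip:
  assumes "reduced_word w"
  shows "free_cons (flip x) (free_cons x w) = w"
  using assms
  by (cases w; cases "tl w")
     (auto simp: free_cons_def reduced_word_def)

lemma free_mult_closed:
  assumes "fst ` set u \<subseteq> Q" "v \<in> carrier (free_group Q)"
  shows "foldr free_cons u v \<in> carrier (free_group Q)"
  using assms(1) by (induction u) (auto intro: free_cons_closed simp: assms(2))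

lemma free_mult_Nil:
  assumes "reduced_word w"
  shows "foldr free_cons w [] = w"
  using assms
  by (induction w) (auto simp: reduced_word_def successively_Cons free_cons_def split: list.splits)

lemma free_mult_cons:
  assumes "reduced_word u" "reduced_word w"
  shows "foldr free_cons (free_cons x u) w = free_cons x (foldr free_cons u w)"
proof (cases u)
  case (Cons y u')
  have "reduced_word (foldr free_cons u' w)"
    using free_mult_closed[of u' UNIV w] assms(2) by (simp add: free_group_def)
  then show ?thesis
    using Cons free_cons_flip[of "foldr free_cons u' w" "flip x"]
    by (simp add: free_cons_def[of x "y # u'"])
qed (simp add: free_cons_def)

lemma free_mult_assoc:
  assumes "reduced_word v" "reduced_word w"
  shows "foldr free_cons (foldr free_cons u v) w = foldr free_cons u (foldr free_cons v w)"
proof (induction u)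
  case (Cons x u)
  have "reduced_word (foldr free_cons u v)"
    using free_mult_closed[of u UNIV v] assms(1) by (simp add: free_group_def)
  then show ?case
    using Cons free_mult_cons[OF _ assms(2)] by simp
qed simp

lemma group_free_group: "group (free_group Q)"
proof (rule groupI)
  fix u assume u: "u \<in> carrier (free_group Q)"
  have "foldr free_cons (rev (map flip u)) (foldr free_cons u v) = v" if "reduced_word v" for v
  proof (induction u)
    case (Cons x u)
    have "reduced_word (foldr free_cons u v)"
      using free_mult_closed[of u UNIV v] that by (simp add: free_group_def)
    then show ?case
      using Cons by (simp add: free_cons_flip)
  qed simp
  moreover have "foldr free_cons u [] = u"
    using u free_mult_Nil[of u] by (simp add: free_group_def)
  moreover have "reduced_word []"
    by (simp add: reduced_word_def)
  ultimately have "foldr free_cons (rev (map flip u)) u = []"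
    by metis
  moreover have "reduced_word (rev (map flip u))"
  proof -
    have "successively (\<lambda>x y. flip x \<noteq> y) u"
      using u by (auto simp: free_group_def reduced_word_def elim: successively_mono)
    then show ?thesis
      by (simp add: reduced_word_def successively_rev successively_map)
  qed
  moreover have "fst ` set (rev (map flip u)) \<subseteq> Q"
    using u by (auto simp: free_group_def)
  ultimately show "\<exists>y\<in>carrier (free_group Q). y \<otimes>\<^bsub>free_group Q\<^esub> u = \<one>\<^bsub>free_group Q\<^esub>"
    by (intro bexI[of _ "rev (map flip u)"]) (simp_all add: free_group_def)
next
  fix u v assume "u \<in> carrier (free_group Q)" "v \<in> carrier (free_group Q)"
  then show "u \<otimes>\<^bsub>free_group Q\<^esub> v \<in> carrier (free_group Q)"
    using free_mult_closed[of u Q v] by (simp add: free_group_def)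
next
  show "\<one>\<^bsub>free_group Q\<^esub> \<in> carrier (free_group Q)"
    by (simp add: free_group_def reduced_word_def)
qed (simp_all add: free_group_def free_mult_assoc)

section \<open>Bireversible groups\<close>

record ('a, 'q) mealy =
  alphabet :: "'a set"
  states :: "'q set"
  out :: "'q \<Rightarrow> 'a \<Rightarrow> 'a"
  nxt :: "'q \<Rightarrow> 'a \<Rightarrow> 'q"

definition mealy_automaton :: "('a, 'q) mealy \<Rightarrow> bool" where
  "mealy_automaton M \<longleftrightarrow>
     finite (alphabet M) \<and> finite (states M) \<and>
     (\<forall>q\<in>states M. \<forall>a\<in>alphabet M. out M q a \<in> alphabet M \<and> nxt M q a \<in> states M)"

definition invertible_automaton :: "('a, 'q) mealy \<Rightarrow> bool" where
  "invertible_automaton M \<longleftrightarrow> (\<forall>q\<in>states M. bij_betw (out M q) (alphabet M) (alphabet M))"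

definition reversible_automaton :: "('a, 'q) mealy \<Rightarrow> bool" where
  "reversible_automaton M \<longleftrightarrow>
     (\<forall>a\<in>alphabet M. bij_betw (\<lambda>q. nxt M q a) (states M) (states M))"

definition bireversible_automaton :: "('a, 'q) mealy \<Rightarrow> bool" where
  "bireversible_automaton M \<longleftrightarrow>
     mealy_automaton M \<and> invertible_automaton M \<and> reversible_automaton M \<and>
     bij_betw (\<lambda>(q, a). (out M q a, nxt M q a))
       (states M \<times> alphabet M) (alphabet M \<times> states M)"

fun out_word :: "('a, 'q) mealy \<Rightarrow> 'q \<Rightarrow> 'a list \<Rightarrow> 'a list" where
  "out_word M q [] = []"
| "out_word M q (a # w) = out M q a # out_word M (nxt M q a) w"

definition state_perm :: "('a, 'q) mealy \<Rightarrow> 'q \<Rightarrow> 'a list \<Rightarrow> 'a list" where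
  "state_perm M q = restrict (out_word M q) (lists (alphabet M))"

definition word_perm :: "('a, 'q) mealy \<Rightarrow> ('q \<times> bool) list \<Rightarrow> 'a list \<Rightarrow> 'a list" where
  "word_perm M w =
     (let B = BijGroup (lists (alphabet M)) in
      foldr (\<lambda>(q, b) g. (if b then state_perm M q else inv\<^bsub>B\<^esub> (state_perm M q)) \<otimes>\<^bsub>B\<^esub> g) w \<one>\<^bsub>B\<^esub>)"

definition mealy_group :: "('a, 'q) mealy \<Rightarrow> ('q \<times> bool) list set monoid" where
  "mealy_group M =
     free_group (states M) Mod
       kernel (free_group (states M)) (BijGroup (lists (alphabet M))) (word_perm M)"

text \<open>
  Alphabet and state set are finite, so up to relabelling they are sets of natural numbers.
\<close>

definition bireversible_group :: "('g, 'm) monoid_scheme \<Rightarrow> bool" where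
  "bireversible_group G \<longleftrightarrow>
     (\<exists>M :: (nat, nat) mealy. bireversible_automaton M \<and> G \<cong> mealy_group M)"

section \<open>Graphs and their automorphism groups\<close>

text \<open>
  A graph with loops and multiple edges is a \<^locale>\<open>bidirected_digraph\<close>: every edge is a pair
  of opposite arcs \<open>e\<close> and \<open>r e \<noteq> e\<close>. In particular the inversion of a loop is an automorphism,
  just as it is a nontrivial isometry of the associated CW-complex.
  Connected locally finite graphs are countable, so up to isomorphism their vertices and arcs are
  natural numbers.
\<close>

definition locally_finite :: "('v, 'e) pre_digraph \<Rightarrow> bool" where
  "locally_finite X \<longleftrightarrow> (\<forall>v\<in>verts X. finite (out_arcs X v))"

definition graph_Aut ::
  "('v, 'e) pre_digraph \<Rightarrow> ('e \<Rightarrow> 'e) \<Rightarrow> (('v \<Rightarrow> 'v) \<times> ('e \<Rightarrow> 'e)) monoid" where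
  "graph_Aut X r =
     \<lparr>carrier = {(s, t). s permutes verts X \<and> t permutes arcs X \<and>
        (\<forall>e\<in>arcs X. tail X (t e) = s (tail X e) \<and> head X (t e) = s (head X e) \<and>
                    t (r e) = r (t e))},
      mult = \<lambda>(s, t) (s', t'). (s \<circ> s', t \<circ> t'),
      one = (id, id)\<rparr>"

lemma group_graph_Aut:
  assumes "bidirected_digraph X r"
  shows "group (graph_Aut X r)"
proof (rule groupI)
  interpret bidirected_digraph X r by fact
  fix g assume g: "g \<in> carrier (graph_Aut X r)"
  obtain s t where [simp]: "g = (s, t)" by fastforce
  have p: "s permutes verts X" "t permutes arcs X"
    using g by (auto simp: graph_Aut_def)
  have "tail X (inv_into UNIV t e) = inv_into UNIV s (tail X e) \<and> head X (inv_into UNIV t e) = inv_into UNIV s (head X e) \<and>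
        inv_into UNIV t (r e) = r (inv_into UNIV t e)" if "e \<in> arcs X" for e
  proof -
    have e: "inv_into UNIV t e \<in> arcs X"
      using that p permutes_inv permutes_in_image by metis
    moreover have "t (inv_into UNIV t e) = e"
      using p permutes_inverses by metis
    ultimately have "tail X e = s (tail X (inv_into UNIV t e))" "head X e = s (head X (inv_into UNIV t e))"
        "r e = t (r (inv_into UNIV t e))"
      using g by (auto simp: graph_Aut_def)
    then show ?thesis
      using p permutes_inverses by metis
  qed
  then have "(inv_into UNIV s, inv_into UNIV t) \<in> carrier (graph_Aut X r)"
    using p by (auto simp: graph_Aut_def permutes_inv)
  moreover have "(inv_into UNIV s, inv_into UNIV t) \<otimes>\<^bsub>graph_Aut X r\<^esub> g = \<one>\<^bsub>graph_Aut X r\<^esub>"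
    using p by (simp add: graph_Aut_def permutes_inv_o)
  ultimately show "\<exists>h\<in>carrier (graph_Aut X r). h \<otimes>\<^bsub>graph_Aut X r\<^esub> g = \<one>\<^bsub>graph_Aut X r\<^esub>"
    by blast
next
  interpret bidirected_digraph X r by fact
  fix g h assume "g \<in> carrier (graph_Aut X r)" "h \<in> carrier (graph_Aut X r)"
  then show "g \<otimes>\<^bsub>graph_Aut X r\<^esub> h \<in> carrier (graph_Aut X r)"
    by (auto simp: graph_Aut_def permutes_compose permutes_in_image)
qed (auto simp: graph_Aut_def permutes_id[unfolded id_def[symmetric]])

text \<open>
  Automorphisms are the identity outside \<open>verts X\<close> and \<open>arcs X\<close>, so pointwise convergence on the
  whole types is pointwise convergence on vertices and edges.
\<close>

definition Aut_topology ::
  "('v, 'e) pre_digraph \<Rightarrow> ('e \<Rightarrow> 'e) \<Rightarrow> (('v \<Rightarrow> 'v) \<times> ('e \<Rightarrow> 'e)) topology" where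
  "Aut_topology X r =
     subtopology
       (prod_topology (product_topology (\<lambda>_. discrete_topology UNIV) UNIV)
                      (product_topology (\<lambda>_. discrete_topology UNIV) UNIV))
       (carrier (graph_Aut X r))"

section \<open>The associated 1-dimensional CW-complex\<close>

text \<open>
  \<open>edge_point X r e t\<close> is the point at parameter \<open>t \<in> [0,1]\<close> of the arc \<open>e\<close>. Points are modelled as
  the equivalence classes under the identifications \<open>(e, t) \<sim> (r e, 1 - t)\<close>, \<open>(e, 0) \<sim> tail X e\<close>
  and \<open>(e, 1) \<sim> head X e\<close>; the class of a vertex is represented by that vertex alone.
\<close>

definition edge_point ::
  "('v, 'e) pre_digraph \<Rightarrow> ('e \<Rightarrow> 'e) \<Rightarrow> 'e \<Rightarrow> real \<Rightarrow> ('v + 'e \<times> real) set" where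
  "edge_point X r e t =
     (if t = 0 then {Inl (tail X e)} else if t = 1 then {Inl (head X e)}
      else {Inr (e, t), Inr (r e, 1 - t)})"

definition realization ::
  "('v, 'e) pre_digraph \<Rightarrow> ('e \<Rightarrow> 'e) \<Rightarrow> ('v + 'e \<times> real) set set" where
  "realization X r =
     (\<lambda>v. {Inl v}) ` verts X \<union> {edge_point X r e t | e t. e \<in> arcs X \<and> t \<in> {0..1}}"

definition realization_topology ::
  "('v, 'e) pre_digraph \<Rightarrow> ('e \<Rightarrow> 'e) \<Rightarrow> ('v + 'e \<times> real) set topology" where
  "realization_topology X r =
     topology (\<lambda>U. U \<subseteq> realization X r \<and>
       (\<forall>e\<in>arcs X. openin (top_of_set {0..1}) {t \<in> {0..1}. edge_point X r e t \<in> U}))"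

lemma openin_realization_topology:
  "openin (realization_topology X r) U \<longleftrightarrow>
     U \<subseteq> realization X r \<and>
     (\<forall>e\<in>arcs X. openin (top_of_set {0..1}) {t \<in> {0..1}. edge_point X r e t \<in> U})"
proof -
  let ?P = "\<lambda>e U. {t \<in> {0..1}. edge_point X r e t \<in> U}"
  have "?P e (U \<inter> V) = ?P e U \<inter> ?P e V" for e U V
    by auto
  moreover have "?P e (\<Union>\<U>) = (\<Union>U\<in>\<U>. ?P e U)" for e \<U>
    by auto
  ultimately have "istopology (\<lambda>U. U \<subseteq> realization X r \<and>
       (\<forall>e\<in>arcs X. openin (top_of_set {0..1}) (?P e U)))"
    unfolding istopology_def by (auto intro: openin_Int openin_Union)
  then show ?thesis
    by (simp add: realization_topology_def topology_inverse')
qed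

text \<open>
  The path metric in which every edge has length 1: \<open>path_length X r p l q\<close> says that \<open>q\<close> is reached
  from \<open>p\<close> by finitely many moves inside single edges of total length \<open>l\<close>.
\<close>

inductive path_length ::
  "('v, 'e) pre_digraph \<Rightarrow> ('e \<Rightarrow> 'e) \<Rightarrow>
   ('v + 'e \<times> real) set \<Rightarrow> real \<Rightarrow> ('v + 'e \<times> real) set \<Rightarrow> bool"
  for X r where
  refl: "p \<in> realization X r \<Longrightarrow> path_length X r p 0 p"
| step: "path_length X r p l (edge_point X r e s) \<Longrightarrow> e \<in> arcs X \<Longrightarrow> s \<in> {0..1} \<Longrightarrow> t \<in> {0..1} \<Longrightarrow>
    path_length X r p (l + \<bar>t - s\<bar>) (edge_point X r e t)"

definition realization_dist ::
  "('v, 'e) pre_digraph \<Rightarrow> ('e \<Rightarrow> 'e) \<Rightarrow>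
   ('v + 'e \<times> real) set \<Rightarrow> ('v + 'e \<times> real) set \<Rightarrow> real" where
  "realization_dist X r p q = Inf {l. path_length X r p l q}"

definition realization_map ::
  "('v \<Rightarrow> 'v) \<times> ('e \<Rightarrow> 'e) \<Rightarrow> ('v + 'e \<times> real) set \<Rightarrow> ('v + 'e \<times> real) set" where
  "realization_map g p = map_sum (fst g) (map_prod (snd g) id) ` p"

lemma realization_map_edge_point:
  assumes "g \<in> carrier (graph_Aut X r)" "e \<in> arcs X"
  shows "realization_map g (edge_point X r e t) = edge_point X r (snd g e) t"
  using assms by (auto simp: realization_map_def edge_point_def graph_Aut_def)

definition geometric_action ::
  "('g, 'm) monoid_scheme \<Rightarrow> ('v, 'e) pre_digraph \<Rightarrow> ('e \<Rightarrow> 'e) \<Rightarrow>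
   ('g \<Rightarrow> ('v \<Rightarrow> 'v) \<times> ('e \<Rightarrow> 'e)) \<Rightarrow> bool" where
  "geometric_action G X r \<phi> \<longleftrightarrow>
     \<phi> \<in> hom G (graph_Aut X r) \<and>
     (\<forall>g\<in>carrier G. \<forall>p\<in>realization X r. \<forall>q\<in>realization X r.
        realization_dist X r (realization_map (\<phi> g) p) (realization_map (\<phi> g) q) =
        realization_dist X r p q) \<and>
     (\<forall>K. compactin (realization_topology X r) K \<longrightarrow>
        finite {g \<in> carrier G. realization_map (\<phi> g) ` K \<inter> K \<noteq> {}}) \<and>
     (\<exists>K. compactin (realization_topology X r) K \<and>
        (\<Union>g\<in>carrier G. realization_map (\<phi> g) ` K) = realization X r)"

section \<open>Commensurators and topological notions\<close>

definition finite_index :: "('k, 'm) monoid_scheme \<Rightarrow> 'k set \<Rightarrow> 'k set \<Rightarrow> bool" where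
  "finite_index K H L \<longleftrightarrow> finite (rcosets\<^bsub>K\<lparr>carrier := H\<rparr>\<^esub> L)"

definition commensurator :: "('k, 'm) monoid_scheme \<Rightarrow> 'k set \<Rightarrow> 'k set" where
  "commensurator K H =
     {k \<in> carrier K. let H' = k <#\<^bsub>K\<^esub> H #>\<^bsub>K\<^esub> inv\<^bsub>K\<^esub> k in
        finite_index K H (H \<inter> H') \<and> finite_index K H' (H \<inter> H')}"

definition fin_gen_subgroup :: "'k set \<Rightarrow> ('k, 'm) monoid_scheme \<Rightarrow> bool" where
  "fin_gen_subgroup H K \<longleftrightarrow> (\<exists>S. finite S \<and> S \<subseteq> carrier K \<and> H = generate K S)"

definition discrete_subset :: "'k topology \<Rightarrow> 'k set \<Rightarrow> bool" where
  "discrete_subset T H \<longleftrightarrow> subtopology T H = discrete_topology H"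

text \<open>
  The quotient topology on \<open>\<Gamma> Mod N\<close> is the unique one making the projection \<open>g \<mapsto> N g\<close>
  a \<^const>\<open>quotient_map\<close>.
\<close>

definition compact_by_discrete :: "('k, 'm) monoid_scheme \<Rightarrow> 'k topology \<Rightarrow> bool" where
  "compact_by_discrete \<Gamma> T \<longleftrightarrow>
     (\<exists>N. N \<lhd> \<Gamma> \<and> compactin T N \<and>
        quotient_map T (discrete_topology (carrier (\<Gamma> Mod N))) (\<lambda>g. N #>\<^bsub>\<Gamma>\<^esub> g))"

end

theory Submission
  imports Defs
begin

text \<open>
  Let \<open>A\<close> be the alphabet of a bireversible automaton and realise the group as the group \<open>P\<close> that
  the states generate inside the bijections of the set of words over \<open>A\<close>. An element \<open>p\<close> of \<open>P\<close> acts on a word by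
  \<open>p (a w) = b v\<close>, where the letter \<open>b\<close> depends on \<open>a\<close> alone and \<open>v\<close> is the image of \<open>w\<close> under
  another element of \<open>P\<close>, the section \<open>sec a p\<close>. Composing two such maps gives the cocycle identity
  \<open>sec a (p q) = sec (q a) p \<cdot> sec a q\<close>. By reversibility and bireversibility \<open>sec a\<close> maps the set
  of generators and their inverses onto itself, hence every ball of \<open>P\<close> onto itself; balls are
  finite, so \<open>sec a\<close> is a permutation of \<open>P\<close> that fixes the identity.

  The graph \<open>X\<close> is the Cayley graph in which \<open>p\<close> is joined to \<open>d p\<close> for each generator \<open>d\<close>. The group
  acts on it by right translations, simply transitively on vertices and therefore geometrically.
  The cocycle identity shows in addition that each \<open>sec a\<close> is an automorphism of \<open>X\<close>, and that
  the set \<open>S\<close> of these automorphisms and their inverses satisfies \<open>H S \<subseteq> S H\<close> for the group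
  \<open>H\<close> of translations. Hence each \<open>k\<close> in the group \<open>J\<close> generated by \<open>S\<close> lies in a finite set \<open>F\<close> with
  \<open>H F \<subseteq> F H\<close>, which bounds the indices in the definition of the commensurator
  (\<open>generate_subset_commensurator\<close>). The group \<open>J\<close> is infinite because \<open>p\<close> is determined by how the
  elements \<open>k p\<close> with \<open>k\<close> in \<open>J\<close> move the letters: a finite \<open>J\<close> would leave finitely many \<open>p\<close>
  (\<open>finite_sections_imp_finite\<close>). As \<open>J\<close> fixes a vertex, its orbits are finite, and an infinite
  group with finite orbits is not discrete (\<open>infinite_stabilizer_not_discrete\<close>).

  Suppose the automorphism group had a compact open normal subgroup \<open>N\<close>. If \<open>c\<close> lies in \<open>J\<close>
  and in \<open>N\<close>, then \<open>c\<close> has only finitely many conjugates \<open>g c g\<inverse>\<close> with \<open>g\<close> in \<open>H\<close>: exchanging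
  \<open>g c = f h\<close>, with \<open>f\<close> from a finite set, gives \<open>g c g\<inverse> = f (h g\<inverse>)\<close>, and \<open>h g\<inverse>\<close> moves the base
  vertex into a finite set, since \<open>N\<close> has finite orbits. So \<open>c\<close> commutes with a subgroup of
  finite index in \<open>H\<close>. Finitely many Schreier generators of the intersection of \<open>J\<close> and \<open>N\<close>
  commute with a common subgroup \<open>L\<close> of finite index in \<open>H\<close>, so \<open>J\<close> is contained in finitely many
  translates of the centralizer of \<open>L\<close> in \<open>J\<close>. That centralizer is finite, because an element
  commuting with \<open>L\<close> is determined by its values on representatives of the finitely many \<open>L\<close>-orbits
  of vertices. This contradicts the infinity of \<open>J\<close>
  (\<open>finite_generate_if_compact_open_normal\<close>).
\<close>

section \<open>Subgroups that exchange with a finite set\<close>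

lemma finite_image_factor:
  assumes "finite (f ` A)" and "\<And>x y. x \<in> A \<Longrightarrow> y \<in> A \<Longrightarrow> f x = f y \<Longrightarrow> g x = g y"
  shows "finite (g ` A)"
proof -
  have "g ` A \<subseteq> (\<lambda>b. g (SOME x. x \<in> A \<and> f x = b)) ` f ` A"
  proof
    fix c assume "c \<in> g ` A"
    then obtain x where x: "x \<in> A" "c = g x" by blast
    define y where "y = (SOME y. y \<in> A \<and> f y = f x)"
    have "y \<in> A \<and> f y = f x"
      unfolding y_def by (rule someI[of _ x]) (use x in simp)
    with assms(2) x have "c = g y" by metis
    then show "c \<in> (\<lambda>b. g (SOME x. x \<in> A \<and> f x = b)) ` f ` A"
      using x(1) unfolding y_def by blast
  qed
  then show ?thesis
    using assms(1) finite_surj by blast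
qed

lemma finite_reps:
  assumes "finite (f ` A)"
  obtains T where "T \<subseteq> A" "finite T" "\<And>x. x \<in> A \<Longrightarrow> \<exists>t\<in>T. f t = f x"
proof -
  obtain T where T: "T \<subseteq> A" "finite T" "f ` A = f ` T"
    using finite_subset_image[OF assms subset_refl] by blast
  then have "\<exists>t\<in>T. f t = f x" if "x \<in> A" for x
    using that by (metis imageE imageI)
  with T that show thesis by blast
qed

context group
begin

text \<open>
  The inclusion \<open>H F \<subseteq> F H\<close>: elements of \<open>H\<close> can be moved
  past those of \<open>F\<close> from left to right.
\<close>

definition exchange :: "'a set \<Rightarrow> 'a set \<Rightarrow> bool" where
  "exchange H F \<longleftrightarrow> (\<forall>h\<in>H. \<forall>f\<in>F. \<exists>f'\<in>F. \<exists>h'\<in>H. h \<otimes> f = f' \<otimes> h')"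

text \<open>
  Elements of \<open>H\<close> sharing a label from the finite set \<open>C\<close> lie in one
  right coset of \<open>L\<close>. A relation is used because labels found by an existence
  statement need not be unique.
\<close>

lemma finite_indexI:
  assumes H: "subgroup H G" and L: "subgroup L G" "L \<subseteq> H" and C: "finite C"
    and ex: "\<And>g. g \<in> H \<Longrightarrow> \<exists>c\<in>C. R g c"
    and eq: "\<And>g g' c. g \<in> H \<Longrightarrow> g' \<in> H \<Longrightarrow> R g c \<Longrightarrow> R g' c \<Longrightarrow> g \<otimes> inv g' \<in> L"
  shows "finite_index G H L"
proof -
  define f where "f g = (SOME c. c \<in> C \<and> R g c)" for g
  have f: "f g \<in> C \<and> R g (f g)" if "g \<in> H" for g
    unfolding f_def using ex[OF that] by (rule_tac someI_ex) blast
  have "finite (f ` H)"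
    using C f by (meson finite_subset image_subsetI)
  then have "finite ((\<lambda>g. L #> g) ` H)"
  proof (rule finite_image_factor)
    fix g g' assume g: "g \<in> H" "g' \<in> H" "f g = f g'"
    have c: "g \<in> carrier G" "g' \<in> carrier G"
      using g H subgroup.subset by blast+
    have "g \<otimes> inv g' \<in> L"
      using eq[of g g' "f g"] f g by metis
    moreover have "g = (g \<otimes> inv g') \<otimes> g'"
      using c by (simp add: m_assoc)
    ultimately have "g \<in> L #> g'"
      unfolding r_coset_def by blast
    then show "L #> g = L #> g'"
      using repr_independence[OF _ c(2) L(1)] by simp
  qed
  moreover have "rcosets\<^bsub>G\<lparr>carrier := H\<rparr>\<^esub> L = (\<lambda>g. L #> g) ` H"
    by (auto simp: RCOSETS_def r_coset_def)
  ultimately show ?thesis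
    by (simp add: finite_index_def)
qed

lemma mem_conjugate_iff:
  assumes "subgroup H G" "k \<in> carrier G" "x \<in> carrier G"
  shows "x \<in> k <# H #> inv k \<longleftrightarrow> inv k \<otimes> x \<otimes> k \<in> H"
proof
  assume "x \<in> k <# H #> inv k"
  then obtain h where h: "h \<in> H" "x = k \<otimes> h \<otimes> inv k"
    by (auto simp: l_coset_def r_coset_def)
  then have "h \<in> carrier G" using assms(1) subgroup.mem_carrier by metis
  then have "inv k \<otimes> x \<otimes> k = h"
    using assms h by (simp add: m_assoc) (simp add: m_assoc[symmetric])
  then show "inv k \<otimes> x \<otimes> k \<in> H" using h by simp
next
  assume "inv k \<otimes> x \<otimes> k \<in> H"
  moreover have "x = k \<otimes> (inv k \<otimes> x \<otimes> k) \<otimes> inv k"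
    using assms by (simp add: m_assoc) (simp add: m_assoc[symmetric])
  ultimately show "x \<in> k <# H #> inv k"
    unfolding l_coset_def r_coset_def by blast
qed

lemma subgroup_conjugate:
  assumes "subgroup H G" "k \<in> carrier G"
  shows "subgroup (k <# H #> inv k) G"
proof (rule subgroupI)
  have H: "H \<subseteq> carrier G" using assms(1) subgroup.subset by blast
  show sub: "k <# H #> inv k \<subseteq> carrier G"
    using H assms(2) by (auto simp: l_coset_def r_coset_def)
  show "k <# H #> inv k \<noteq> {}"
    using subgroup.one_closed[OF assms(1)] by (auto simp: l_coset_def r_coset_def)
  fix a assume a: "a \<in> k <# H #> inv k"
  then have ac: "a \<in> carrier G" using sub by blast
  have "inv (inv k \<otimes> a \<otimes> k) \<in> H"
    using a ac assms mem_conjugate_iff subgroup.m_inv_closed by metis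
  moreover have "inv (inv k \<otimes> a \<otimes> k) = inv k \<otimes> inv a \<otimes> k"
    using ac assms by (simp add: inv_mult_group m_assoc)
  ultimately show "inv a \<in> k <# H #> inv k"
    using ac assms mem_conjugate_iff by simp
  fix b assume b: "b \<in> k <# H #> inv k"
  then have bc: "b \<in> carrier G" using sub by blast
  have "(inv k \<otimes> a \<otimes> k) \<otimes> (inv k \<otimes> b \<otimes> k) \<in> H"
    using a b ac bc assms mem_conjugate_iff subgroup.m_closed by metis
  moreover have "(inv k \<otimes> a \<otimes> k) \<otimes> (inv k \<otimes> b \<otimes> k) = inv k \<otimes> (a \<otimes> b) \<otimes> k"
    using ac bc assms by (simp add: m_assoc) (simp add: m_assoc[symmetric])
  ultimately show "a \<otimes> b \<in> k <# H #> inv k"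
    using ac bc assms mem_conjugate_iff by simp
qed

text \<open>
  Label \<open>g\<close> in \<open>H\<close> by an element \<open>c\<close> of
  \<open>F\<close> with \<open>g\<inverse> k = c u\<close> and \<open>u\<close> in
  \<open>H\<close>. If \<open>g\<close> and \<open>g'\<close> share the label
  \<open>c\<close>, then \<open>k\<inverse> g g'\<inverse> k = u\<inverse> u'\<close> lies in
  \<open>H\<close>, so \<open>g g'\<inverse>\<close> lies in \<open>k H k\<inverse>\<close>.
  The index in \<open>k H k\<inverse>\<close> is bounded in the same way with
  \<open>k\<inverse>\<close> in place of \<open>k\<close>.
\<close>

lemma commensuratorI_exchange:
  assumes H: "subgroup H G" and k: "k \<in> carrier G"
    and F: "finite F" "F \<subseteq> carrier G" "k \<in> F" "exchange H F"
    and F': "finite F'" "F' \<subseteq> carrier G" "inv k \<in> F'" "exchange H F'"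
  shows "k \<in> commensurator G H"
proof -
  let ?H' = "k <# H #> inv k"
  have Hc: "h \<in> carrier G" if "h \<in> H" for h
    using H that by (rule subgroup.mem_carrier)
  have H': "subgroup ?H' G" using H k by (rule subgroup_conjugate)
  have H'c: "h \<in> carrier G" if "h \<in> ?H'" for h
    using H' that by (rule subgroup.mem_carrier)
  have I: "subgroup (H \<inter> ?H') G" using H H' by (rule subgroups_Inter_pair)
  have "finite_index G H (H \<inter> ?H')"
  proof (rule finite_indexI[where C = F and R = "\<lambda>g c. c \<in> F \<and> (\<exists>u\<in>H. inv g \<otimes> k = c \<otimes> u)"])
    fix g assume "g \<in> H"
    then have "inv g \<in> H" using H subgroup.m_inv_closed by metis
    then show "\<exists>c\<in>F. c \<in> F \<and> (\<exists>u\<in>H. inv g \<otimes> k = c \<otimes> u)"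
      using F(3,4) unfolding exchange_def by blast
  next
    fix g g' c assume g: "g \<in> H" "g' \<in> H"
      and "c \<in> F \<and> (\<exists>u\<in>H. inv g \<otimes> k = c \<otimes> u)" "c \<in> F \<and> (\<exists>u\<in>H. inv g' \<otimes> k = c \<otimes> u)"
    then obtain u u' where u: "u \<in> H" "u' \<in> H" "inv g \<otimes> k = c \<otimes> u" "inv g' \<otimes> k = c \<otimes> u'"
      and c: "c \<in> F" by blast
    have car: "g \<in> carrier G" "g' \<in> carrier G" "u \<in> carrier G" "u' \<in> carrier G" "c \<in> carrier G"
      using g u Hc c F(2) by auto
    have "inv k \<otimes> (g \<otimes> inv g') \<otimes> k = inv (inv g \<otimes> k) \<otimes> (inv g' \<otimes> k)"
      using car k by (simp add: inv_mult_group m_assoc)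
    also have "\<dots> = inv u \<otimes> u'"
      unfolding u(3,4) using car
      by (simp add: inv_mult_group m_assoc) (simp add: m_assoc[symmetric])
    also have "\<dots> \<in> H" using u H by (simp add: subgroup.m_closed subgroup.m_inv_closed)
    finally have "g \<otimes> inv g' \<in> ?H'"
      using mem_conjugate_iff[OF H k] car by simp
    moreover have "g \<otimes> inv g' \<in> H"
      using g H by (simp add: subgroup.m_closed subgroup.m_inv_closed)
    ultimately show "g \<otimes> inv g' \<in> H \<inter> ?H'" by blast
  qed (use H I F in auto)
  moreover have "finite_index G ?H' (H \<inter> ?H')"
  proof (rule finite_indexI[where C = F' and R = "\<lambda>g c. c \<in> F' \<and> (\<exists>u\<in>H. inv k \<otimes> inv g = c \<otimes> u)"])
    fix g assume g: "g \<in> ?H'"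
    then have gc: "g \<in> carrier G" using H'c by blast
    have "inv g \<in> ?H'" using H' g subgroup.m_inv_closed by metis
    then have "inv k \<otimes> inv g \<otimes> k \<in> H"
      using mem_conjugate_iff[OF H k] gc by simp
    then have "\<exists>c\<in>F'. \<exists>u\<in>H. (inv k \<otimes> inv g \<otimes> k) \<otimes> inv k = c \<otimes> u"
      using F'(3,4) unfolding exchange_def by blast
    moreover have "(inv k \<otimes> inv g \<otimes> k) \<otimes> inv k = inv k \<otimes> inv g"
      using k gc by (simp add: m_assoc)
    ultimately show "\<exists>c\<in>F'. c \<in> F' \<and> (\<exists>u\<in>H. inv k \<otimes> inv g = c \<otimes> u)" by auto
  next
    fix g g' c assume g: "g \<in> ?H'" "g' \<in> ?H'"
      and "c \<in> F' \<and> (\<exists>u\<in>H. inv k \<otimes> inv g = c \<otimes> u)" "c \<in> F' \<and> (\<exists>u\<in>H. inv k \<otimes> inv g' = c \<otimes> u)"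
    then obtain u u' where u: "u \<in> H" "u' \<in> H" "inv k \<otimes> inv g = c \<otimes> u" "inv k \<otimes> inv g' = c \<otimes> u'"
      and c: "c \<in> F'" by blast
    have car: "g \<in> carrier G" "g' \<in> carrier G" "u \<in> carrier G" "u' \<in> carrier G" "c \<in> carrier G"
      using g u Hc H'c c F'(2) by auto
    have "g \<otimes> inv g' = inv (inv k \<otimes> inv g) \<otimes> (inv k \<otimes> inv g')"
      using car k by (simp add: inv_mult_group m_assoc) (simp add: m_assoc[symmetric])
    also have "\<dots> = inv u \<otimes> u'"
      unfolding u(3,4) using car
      by (simp add: inv_mult_group m_assoc) (simp add: m_assoc[symmetric])
    also have "\<dots> \<in> H" using u H by (simp add: subgroup.m_closed subgroup.m_inv_closed)
    finally have "g \<otimes> inv g' \<in> H" .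
    moreover have "g \<otimes> inv g' \<in> ?H'"
      using g H' by (simp add: subgroup.m_closed subgroup.m_inv_closed)
    ultimately show "g \<otimes> inv g' \<in> H \<inter> ?H'" by blast
  qed (use H' I F' in auto)
  ultimately show ?thesis
    using k by (simp add: commensurator_def Let_def)
qed

text \<open>
  The relation \<open>H F \<subseteq> F H\<close> passes to products of finite sets, so a word
  of length \<open>n\<close> in \<open>S\<close> lies in the finite exchanging set of all
  words of that length.
\<close>

lemma exchange_generate:
  assumes H: "subgroup H G" and S: "finite S" "S \<subseteq> carrier G" "\<And>s. s \<in> S \<Longrightarrow> inv s \<in> S"
    and ex: "exchange H S" and k: "k \<in> generate G S"
  obtains F where "finite F" "F \<subseteq> generate G S" "k \<in> F" "exchange H F"
proof -
  have "\<exists>F. finite F \<and> F \<subseteq> generate G S \<and> k \<in> F \<and> exchange H F"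
    using k
  proof (induction rule: generate.induct)
    case one
    have "exchange H {\<one>}"
      unfolding exchange_def using subgroup.mem_carrier[OF H] by fastforce
    then show ?case by (intro exI[of _ "{\<one>}"]) (auto intro: generate.one)
  next
    case (incl s)
    then show ?case using S ex by (intro exI[of _ S]) (auto intro: generate.incl)
  next
    case (inv s)
    then show ?case using S ex by (intro exI[of _ S]) (auto intro: generate.incl)
  next
    case (eng k1 k2)
    then obtain F1 F2 where F1: "finite F1" "F1 \<subseteq> generate G S" "k1 \<in> F1" "exchange H F1"
      and F2: "finite F2" "F2 \<subseteq> generate G S" "k2 \<in> F2" "exchange H F2" by blast
    let ?F = "(\<lambda>(x, y). x \<otimes> y) ` (F1 \<times> F2)"
    have car: "x \<in> carrier G" if "x \<in> generate G S" for x
      using S(2) that by (rule generate_in_carrier)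
    have "exchange H ?F"
      unfolding exchange_def
    proof (intro ballI)
      fix h f assume h: "h \<in> H" and "f \<in> ?F"
      then obtain x y where f: "x \<in> F1" "y \<in> F2" "f = x \<otimes> y" by auto
      obtain x' h' where 1: "x' \<in> F1" "h' \<in> H" "h \<otimes> x = x' \<otimes> h'"
        using F1(4) h f(1) unfolding exchange_def by blast
      obtain y' h'' where 2: "y' \<in> F2" "h'' \<in> H" "h' \<otimes> y = y' \<otimes> h''"
        using F2(4) 1(2) f(2) unfolding exchange_def by blast
      have c: "x \<in> carrier G" "y \<in> carrier G" "x' \<in> carrier G" "y' \<in> carrier G"
        "h \<in> carrier G" "h' \<in> carrier G" "h'' \<in> carrier G"
        using f 1 2 h F1(2) F2(2) car subgroup.mem_carrier[OF H] by blast+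
      have "h \<otimes> f = (x' \<otimes> y') \<otimes> h''"
        using c f 1(3) 2(3) by (metis m_assoc m_closed)
      then show "\<exists>f'\<in>?F. \<exists>h'\<in>H. h \<otimes> f = f' \<otimes> h'"
        using 1 2 by force
    qed
    moreover have "finite ?F" using F1 F2 by simp
    moreover have "?F \<subseteq> generate G S" using F1 F2 by (auto intro!: generate.eng)
    moreover have "k1 \<otimes> k2 \<in> ?F" using F1 F2 by force
    ultimately show ?case by blast
  qed
  then show thesis using that by blast
qed

lemma generate_subset_commensurator:
  assumes H: "subgroup H G" and S: "finite S" "S \<subseteq> carrier G" "\<And>s. s \<in> S \<Longrightarrow> inv s \<in> S"
    and ex: "exchange H S"
  shows "generate G S \<subseteq> commensurator G H"
proof
  fix k assume k: "k \<in> generate G S"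
  have sub: "generate G S \<subseteq> carrier G" using S(2) by (rule generate_incl)
  obtain F where F: "finite F" "F \<subseteq> generate G S" "k \<in> F" "exchange H F"
    using exchange_generate[OF H S ex k] by blast
  have "inv k \<in> generate G S" using generate_m_inv_closed[OF S(2) k] .
  then obtain F' where F': "finite F'" "F' \<subseteq> generate G S" "inv k \<in> F'" "exchange H F'"
    using exchange_generate[OF H S ex] by blast
  show "k \<in> commensurator G H"
    by (rule commensuratorI_exchange[OF H _ F(1) _ F(3,4) F'(1) _ F'(3,4)])
       (use k sub F F' in auto)
qed

text \<open>
  Here \<open>N\<close> plays the role of a compact normal subgroup and \<open>H\<close> that
  of a group acting freely. If \<open>g c = f h\<close> is obtained by exchanging, then
  \<open>g c g\<inverse> = f (h g\<inverse>)\<close> lies in \<open>N\<close>, so \<open>h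
  g\<inverse>\<close> moves \<open>x\<close> into the finite set \<open>f\<inverse> N
  x\<close>; this leaves finitely many \<open>h g\<inverse>\<close>.
\<close>

lemma finite_conjugates:
  assumes H: "subgroup H G" and N: "N \<lhd> G"
    and act_mult: "\<And>g h. g \<in> carrier G \<Longrightarrow> h \<in> carrier G \<Longrightarrow> act (g \<otimes> h) = act g \<circ> act h"
    and inj: "inj_on (\<lambda>h. act h x) H"
    and Nx: "finite ((\<lambda>n. act n x) ` N)"
    and F: "finite F" "F \<subseteq> carrier G" "exchange H F" "c \<in> F" and c: "c \<in> N"
  shows "finite ((\<lambda>g. g \<otimes> c \<otimes> inv g) ` H)"
proof -
  have Hc: "h \<in> carrier G" if "h \<in> H" for h
    using H that by (rule subgroup.mem_carrier)
  \<comment> \<open>Images of \<open>x\<close> under the elements \<open>h g\<inverse>\<close> that can occur.\<close>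
  define Y where "Y = (\<Union>f\<in>F. act (inv f) ` (\<lambda>n. act n x) ` N)"
  define U where "U = (\<lambda>h. act h x) -` Y \<inter> H"
  have "finite Y" unfolding Y_def using F(1) Nx by blast
  then have "finite U" unfolding U_def using inj by (rule finite_vimage_IntI)
  moreover have "(\<lambda>g. g \<otimes> c \<otimes> inv g) ` H \<subseteq> (\<lambda>(f, u). f \<otimes> u) ` (F \<times> U)"
  proof
    fix d assume "d \<in> (\<lambda>g. g \<otimes> c \<otimes> inv g) ` H"
    then obtain g where g: "g \<in> H" "d = g \<otimes> c \<otimes> inv g" by blast
    obtain f h where f: "f \<in> F" "h \<in> H" "g \<otimes> c = f \<otimes> h"
      using F(3,4) g(1) unfolding exchange_def by blast
    have car: "g \<in> carrier G" "f \<in> carrier G" "h \<in> carrier G" "c \<in> carrier G"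
      using g f F Hc by auto
    let ?u = "h \<otimes> inv g"
    have u: "?u \<in> H" using f g H by (simp add: subgroup.m_closed subgroup.m_inv_closed)
    have d: "d = f \<otimes> ?u" using g(2) f(3) car by (simp add: m_assoc)
    have "d \<in> N" using normal.inv_op_closed2[OF N car(1) c] g(2) by simp
    moreover have "act ?u x = act (inv f) (act d x)"
      using act_mult[of "inv f" d] d car by (simp add: m_assoc[symmetric])
    ultimately have "act ?u x \<in> Y" unfolding Y_def using f(1) by blast
    then have "?u \<in> U" unfolding U_def using u by simp
    then show "d \<in> (\<lambda>(f, u). f \<otimes> u) ` (F \<times> U)" using d f(1) by force
  qed
  ultimately show ?thesis using F(1) by (meson finite_SigmaI finite_surj)
qed

text \<open>
  Schreier's argument. The elements of \<open>C\<close> are the Schreier generators of the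
  part of the generated group that lies in \<open>N\<close>, for the transversal
  \<open>T\<close>. Reading a word letter by letter and correcting by \<open>T\<close> writes
  it as a product of such generators followed by an element of \<open>T\<close>; if
  \<open>L\<close> commutes with all of them, it commutes with the product.
\<close>

lemma generate_covered_by_centralizer:
  assumes S: "finite S" "S \<subseteq> carrier G" "\<And>s. s \<in> S \<Longrightarrow> inv s \<in> S"
    and T: "finite T" "T \<subseteq> generate G S" "\<one> \<in> T"
    and cover: "\<And>k. k \<in> generate G S \<Longrightarrow> \<exists>t\<in>T. k \<otimes> inv t \<in> N"
  defines "C \<equiv> (\<lambda>(t, s, t'). t \<otimes> s \<otimes> inv t') ` (T \<times> S \<times> T) \<inter> N"
  defines "Z \<equiv> \<lambda>L. {k \<in> generate G S. \<forall>g\<in>L. g \<otimes> k = k \<otimes> g}"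
  assumes L: "L \<subseteq> carrier G" "\<And>g c. g \<in> L \<Longrightarrow> c \<in> C \<Longrightarrow> g \<otimes> c = c \<otimes> g"
  shows "generate G S \<subseteq> (\<lambda>(z, t). z \<otimes> t) ` (Z L \<times> T)"
proof
  let ?J = "generate G S"
  have J: "subgroup ?J G" using S(2) by (rule generate_is_subgroup)
  have Jc: "k \<in> carrier G" if "k \<in> ?J" for k
    using J that by (rule subgroup.mem_carrier)
  have Tc: "t \<in> carrier G" if "t \<in> T" for t using that T Jc by blast
  have Lc: "g \<in> carrier G" if "g \<in> L" for g using that L by blast
  have Z1: "\<one> \<in> Z L"
    unfolding Z_def using Lc subgroup.one_closed[OF J] by simp
  have Zm: "z \<otimes> z' \<in> Z L" if "z \<in> Z L" "z' \<in> Z L" for z z'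
  proof -
    have c: "z \<in> carrier G" "z' \<in> carrier G" using that Jc unfolding Z_def by auto
    have "g \<otimes> (z \<otimes> z') = z \<otimes> z' \<otimes> g" if "g \<in> L" for g
    proof -
      have "g \<otimes> z = z \<otimes> g" "g \<otimes> z' = z' \<otimes> g"
        using that \<open>z \<in> Z L\<close> \<open>z' \<in> Z L\<close> unfolding Z_def by auto
      then show ?thesis using c Lc[OF that] by (metis m_assoc)
    qed
    then show ?thesis
      using that subgroup.m_closed[OF J] unfolding Z_def by blast
  qed
  have step: "\<exists>z\<in>Z L. \<exists>t'\<in>T. t \<otimes> s = z \<otimes> t'" if t: "t \<in> T" and s: "s \<in> S" for t s
  proof -
    have sJ: "s \<in> ?J" using s by (rule generate.incl)
    have ts: "t \<otimes> s \<in> ?J" by (rule generate.eng) (use T(2) t sJ in auto)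
    then obtain t' where t': "t' \<in> T" "t \<otimes> s \<otimes> inv t' \<in> N" using cover by blast
    let ?c = "t \<otimes> s \<otimes> inv t'"
    have "?c \<in> C" unfolding C_def using t s t' by force
    moreover have "?c \<in> ?J"
      using ts t' T(2) J by (meson subgroup.m_closed subgroup.m_inv_closed subsetD)
    moreover from \<open>?c \<in> C\<close> have "g \<otimes> ?c = ?c \<otimes> g" if "g \<in> L" for g
      using that by (intro L(2))
    ultimately have "?c \<in> Z L" unfolding Z_def by blast
    moreover have "t \<otimes> s = ?c \<otimes> t'"
      using Tc[OF t] Tc[OF t'(1)] Jc[OF sJ] by (simp add: m_assoc)
    ultimately show ?thesis using t' by blast
  qed
  fix k assume k: "k \<in> ?J"
  have "\<forall>t\<in>T. \<exists>z\<in>Z L. \<exists>t'\<in>T. t \<otimes> k = z \<otimes> t'"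
    using k
  proof (induction rule: generate.induct)
    case one
    show ?case
    proof
      fix t assume t: "t \<in> T"
      then have "t \<otimes> \<one> = \<one> \<otimes> t" using Tc by simp
      then show "\<exists>z\<in>Z L. \<exists>t'\<in>T. t \<otimes> \<one> = z \<otimes> t'" using Z1 t by blast
    qed
  next
    case (incl s)
    then show ?case using step by blast
  next
    case (inv s)
    then show ?case using step S(3) by blast
  next
    case (eng k1 k2)
    show ?case
    proof
      fix t assume t: "t \<in> T"
      obtain z1 t1 where 1: "z1 \<in> Z L" "t1 \<in> T" "t \<otimes> k1 = z1 \<otimes> t1"
        using eng t by blast
      obtain z2 t2 where 2: "z2 \<in> Z L" "t2 \<in> T" "t1 \<otimes> k2 = z2 \<otimes> t2"
        using eng 1(2) by blast
      have c: "z1 \<in> carrier G" "z2 \<in> carrier G" "k1 \<in> carrier G" "k2 \<in> carrier G"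
        "t \<in> carrier G" "t1 \<in> carrier G" "t2 \<in> carrier G"
        using 1 2 eng t Tc Jc unfolding Z_def by auto
      have "t \<otimes> (k1 \<otimes> k2) = (z1 \<otimes> z2) \<otimes> t2"
        using c 1(3) 2(3) by (metis m_assoc m_closed)
      then show "\<exists>z\<in>Z L. \<exists>t'\<in>T. t \<otimes> (k1 \<otimes> k2) = z \<otimes> t'"
        using Zm[OF 1(1) 2(1)] 2(2) by blast
    qed
  qed
  then obtain z t where "z \<in> Z L" "t \<in> T" "\<one> \<otimes> k = z \<otimes> t" using T(3) by blast
  then show "k \<in> (\<lambda>(z, t). z \<otimes> t) ` (Z L \<times> T)"
    using Jc[OF k] by force
qed

text \<open>
  The elements of \<open>H\<close> commuting with \<open>C\<close> form a subgroup
  \<open>L\<close> of finite index, as each \<open>c\<close> has finitely many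
  \<open>H\<close>-conjugates. A permutation commuting with \<open>L\<close> is determined by
  its values at representatives of the \<open>L\<close>-orbits, and there are finitely many
  choices for these values.
\<close>

lemma finite_centralizer:
  assumes H: "subgroup H G"
    and act_mult: "\<And>g h. g \<in> carrier G \<Longrightarrow> h \<in> carrier G \<Longrightarrow> act (g \<otimes> h) = act g \<circ> act h"
    and faithful: "\<And>g h. g \<in> carrier G \<Longrightarrow> h \<in> carrier G \<Longrightarrow>
      (\<And>v. v \<in> V \<Longrightarrow> act g v = act h v) \<Longrightarrow> g = h"
    and trans: "V = (\<lambda>h. act h x) ` H"
    and K: "K \<subseteq> carrier G" "\<And>v. v \<in> V \<Longrightarrow> finite ((\<lambda>k. act k v) ` K)"
    and C: "finite C" "C \<subseteq> carrier G" "\<And>c. c \<in> C \<Longrightarrow> finite ((\<lambda>g. g \<otimes> c \<otimes> inv g) ` H)"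
  shows "finite {k \<in> K. \<forall>g\<in>{g \<in> H. \<forall>c\<in>C. g \<otimes> c = c \<otimes> g}. g \<otimes> k = k \<otimes> g}" (is "finite ?Z")
proof -
  define L where "L = {g \<in> H. \<forall>c\<in>C. g \<otimes> c = c \<otimes> g}"
  have Hc: "h \<in> carrier G" if "h \<in> H" for h
    using H that by (rule subgroup.mem_carrier)
  \<comment> \<open>Elements with equal \<open>f\<close> differ by a left factor commuting with \<open>C\<close>.\<close>
  define f where "f g = (\<lambda>c\<in>C. inv g \<otimes> c \<otimes> g)" for g
  have "f ` H \<subseteq> PiE C (\<lambda>c. (\<lambda>g. g \<otimes> c \<otimes> inv g) ` H)"
  proof -
    have "inv g \<otimes> c \<otimes> g \<in> (\<lambda>g. g \<otimes> c \<otimes> inv g) ` H" if "g \<in> H" for g c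
      using that Hc[OF that] subgroup.m_inv_closed[OF H that]
      by (intro image_eqI[of _ _ "inv g"]) auto
    then show ?thesis unfolding f_def by auto
  qed
  then have "finite (f ` H)" using C by (meson finite_PiE finite_subset)
  then obtain R where R: "R \<subseteq> H" "finite R" "\<And>g. g \<in> H \<Longrightarrow> \<exists>r\<in>R. f r = f g"
    by (rule finite_reps) blast
  have RV: "act r x \<in> V" if "r \<in> R" for r using that R(1) trans by blast
  define e where "e k = (\<lambda>r\<in>R. act k (act r x))" for k
  have "e ` ?Z \<subseteq> PiE R (\<lambda>r. (\<lambda>k. act k (act r x)) ` K)"
    unfolding e_def by auto
  then have "finite (e ` ?Z)"
    using R(2) K(2) RV by (meson finite_PiE finite_subset)
  moreover have "inj_on e ?Z"
  proof (rule inj_onI)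
    fix k k' assume k: "k \<in> ?Z" "k' \<in> ?Z" and e: "e k = e k'"
    have kc: "k \<in> carrier G" "k' \<in> carrier G" using k K by auto
    have "act k v = act k' v" if "v \<in> V" for v
    proof -
      obtain g where g: "g \<in> H" "v = act g x" using \<open>v \<in> V\<close> trans by blast
      obtain r where r: "r \<in> R" "f r = f g" using R(3) g(1) by blast
      have rH: "r \<in> H" using r R by blast
      note car = Hc[OF g(1)] Hc[OF rH]
      let ?l = "g \<otimes> inv r"
      have lc: "?l \<in> carrier G" using car by simp
      have "?l \<otimes> c = c \<otimes> ?l" if c: "c \<in> C" for c
      proof -
        have cc: "c \<in> carrier G" using c C by blast
        have "inv r \<otimes> c \<otimes> r = inv g \<otimes> c \<otimes> g"
          using fun_cong[OF r(2), of c] c unfolding f_def by simp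
        then have "g \<otimes> (inv r \<otimes> c \<otimes> r) \<otimes> inv r = g \<otimes> (inv g \<otimes> c \<otimes> g) \<otimes> inv r"
          by simp
        moreover have "g \<otimes> (inv r \<otimes> c \<otimes> r) \<otimes> inv r = ?l \<otimes> c"
          using car cc by (simp add: m_assoc)
        moreover have "g \<otimes> (inv g \<otimes> c \<otimes> g) \<otimes> inv r = c \<otimes> ?l"
          using car cc by (simp add: m_assoc) (simp add: m_assoc[symmetric])
        ultimately show ?thesis by simp
      qed
      then have l: "?l \<in> L"
        unfolding L_def using g(1) rH H by (simp add: subgroup.m_closed subgroup.m_inv_closed)
      have "g = ?l \<otimes> r" using car by (simp add: m_assoc)
      then have v: "v = act ?l (act r x)" using g(2) act_mult lc car by (metis comp_apply)
      have move: "act j v = act ?l (act j (act r x))" if "j \<in> ?Z" for j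
      proof -
        have "j \<in> carrier G" "?l \<otimes> j = j \<otimes> ?l" using that K l unfolding L_def by auto
        then have "act j \<circ> act ?l = act ?l \<circ> act j" using act_mult lc by metis
        then show ?thesis unfolding v by (metis comp_apply)
      qed
      have "act k (act r x) = act k' (act r x)"
        using fun_cong[OF e, of r] r(1) unfolding e_def by simp
      then show ?thesis using move[OF k(1)] move[OF k(2)] by simp
    qed
    then show "k = k'" using faithful kc by blast
  qed
  ultimately show ?thesis using finite_imageD by blast
qed

text \<open>
  The statement is free of topology: compactness of \<open>N\<close> enters as finiteness of
  the orbit of \<open>x\<close>, and openness as the assumption that \<open>N\<close> contains
  the pointwise stabiliser of a finite set \<open>B\<close>. Finiteness of the stabiliser
  orbits then makes \<open>N\<close> meet the generated group in a subgroup of finite index,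
  and the preceding lemmas apply.
\<close>

theorem finite_generate_if_compact_open_normal:
  assumes H: "subgroup H G"
    and act_one: "act \<one> = id"
    and act_mult: "\<And>g h. g \<in> carrier G \<Longrightarrow> h \<in> carrier G \<Longrightarrow> act (g \<otimes> h) = act g \<circ> act h"
    and faithful: "\<And>g h. g \<in> carrier G \<Longrightarrow> h \<in> carrier G \<Longrightarrow>
      (\<And>v. v \<in> V \<Longrightarrow> act g v = act h v) \<Longrightarrow> g = h"
    and simply_trans: "bij_betw (\<lambda>h. act h x) H V"
    and orbit: "\<And>v. v \<in> V \<Longrightarrow> finite ((\<lambda>k. act k v) ` {k \<in> carrier G. act k x = x})"
    and S: "finite S" "S \<subseteq> carrier G" "\<And>s. s \<in> S \<Longrightarrow> inv s \<in> S" "\<And>s. s \<in> S \<Longrightarrow> act s x = x"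
    and ex: "exchange H S"
    and N: "N \<lhd> G" "finite ((\<lambda>n. act n x) ` N)"
    and B: "finite B" "B \<subseteq> V" "\<And>k. k \<in> carrier G \<Longrightarrow> (\<And>v. v \<in> B \<Longrightarrow> act k v = v) \<Longrightarrow> k \<in> N"
  shows "finite (generate G S)"
proof -
  let ?J = "generate G S"
  have J: "subgroup ?J G" using S(2) by (rule generate_is_subgroup)
  have Jc: "k \<in> carrier G" if "k \<in> ?J" for k
    using J that by (rule subgroup.mem_carrier)
  have Jx: "act k x = x" if "k \<in> ?J" for k
    using that
  proof (induction rule: generate.induct)
    case (eng k1 k2)
    then show ?case using act_mult Jc by simp
  qed (use act_one S in auto)
  have JK: "?J \<subseteq> {k \<in> carrier G. act k x = x}" using Jc Jx by blast
  have orbitJ: "finite ((\<lambda>k. act k v) ` ?J)" if "v \<in> V" for v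
    using orbit[OF that] JK by (meson finite_subset image_mono)
  have inv_act: "act k (act (inv k) v) = v" if "k \<in> carrier G" for k v
    using act_mult[of k "inv k"] that act_one by (simp add: fun_eq_iff)
  \<comment> \<open>The inverse is used so that \<open>f k = f t\<close> makes \<open>k t\<inverse>\<close> fix \<open>B\<close> pointwise.\<close>
  define f where "f k = (\<lambda>v\<in>B. act (inv k) v)" for k
  have "f ` ?J \<subseteq> PiE B (\<lambda>v. (\<lambda>k. act k v) ` ?J)"
    unfolding f_def using subgroup.m_inv_closed[OF J] by auto
  then have "finite (f ` ?J)"
    using B orbitJ by (meson finite_PiE finite_subset subsetD)
  then obtain T0 where T0: "T0 \<subseteq> ?J" "finite T0" "\<And>k. k \<in> ?J \<Longrightarrow> \<exists>t\<in>T0. f t = f k"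
    by (rule finite_reps) blast
  define T where "T = insert \<one> T0"
  have T: "finite T" "T \<subseteq> ?J" "\<one> \<in> T"
    unfolding T_def using T0 subgroup.one_closed[OF J] by auto
  have cover: "\<exists>t\<in>T. k \<otimes> inv t \<in> N" if k: "k \<in> ?J" for k
  proof -
    obtain t where t: "t \<in> T0" "f t = f k" using T0(3)[OF k] by blast
    have tJ: "t \<in> ?J" using t T0 by blast
    note c = Jc[OF k] Jc[OF tJ]
    have "act (k \<otimes> inv t) v = v" if "v \<in> B" for v
    proof -
      have "act (inv t) v = act (inv k) v"
        using fun_cong[OF t(2), of v] that unfolding f_def by simp
      then show ?thesis using act_mult[of k "inv t"] c inv_act[of k v] by simp
    qed
    then have "k \<otimes> inv t \<in> N" by (intro B(3)) (use c in auto)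
    then show ?thesis using t unfolding T_def by blast
  qed
  define C where "C = (\<lambda>(t, s, t'). t \<otimes> s \<otimes> inv t') ` (T \<times> S \<times> T) \<inter> N"
  have Cfin: "finite C" unfolding C_def using T S by simp
  have CJ: "C \<subseteq> ?J"
  proof
    fix c assume "c \<in> C"
    then obtain t s t' where c: "t \<in> T" "s \<in> S" "t' \<in> T" "c = t \<otimes> s \<otimes> inv t'"
      unfolding C_def by auto
    then show "c \<in> ?J"
      using T(2) J generate.incl[of s S] by (meson subgroup.m_closed subgroup.m_inv_closed subsetD)
  qed
  have Cconj: "finite ((\<lambda>g. g \<otimes> c \<otimes> inv g) ` H)" if c: "c \<in> C" for c
  proof -
    have cJ: "c \<in> ?J" using c CJ by blast
    have cN: "c \<in> N" using c unfolding C_def by blast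
    obtain F where F: "finite F" "F \<subseteq> ?J" "c \<in> F" "exchange H F"
      using exchange_generate[OF H S(1-3) ex cJ] by blast
    show ?thesis
    proof (rule finite_conjugates[OF H N(1) act_mult _ N(2) F(1) _ F(4,3) cN])
      show "inj_on (\<lambda>h. act h x) H" using simply_trans by (rule bij_betw_imp_inj_on)
      show "F \<subseteq> carrier G" using F(2) Jc by blast
    qed
  qed
  define L where "L = {g \<in> H. \<forall>c\<in>C. g \<otimes> c = c \<otimes> g}"
  have Lsub: "L \<subseteq> carrier G" unfolding L_def using subgroup.subset[OF H] by blast
  define Z where "Z = {k \<in> ?J. \<forall>g\<in>L. g \<otimes> k = k \<otimes> g}"
  have "finite Z"
    unfolding Z_def L_def
  proof (rule finite_centralizer[where act = act and V = V and x = x, OF H])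
    show "V = (\<lambda>h. act h x) ` H" using simply_trans by (simp add: bij_betw_def)
    show "?J \<subseteq> carrier G" using Jc by blast
    show "C \<subseteq> carrier G" using CJ Jc by blast
  qed (fact act_mult faithful orbitJ Cfin Cconj)+
  moreover have "?J \<subseteq> (\<lambda>(z, t). z \<otimes> t) ` (Z \<times> T)"
    unfolding Z_def
  proof (rule generate_covered_by_centralizer[OF S(1-3) T cover Lsub])
    fix g c assume "g \<in> L" "c \<in> (\<lambda>(t, s, t'). t \<otimes> s \<otimes> inv t') ` (T \<times> S \<times> T) \<inter> N"
    then show "g \<otimes> c = c \<otimes> g" unfolding L_def C_def[symmetric] by blast
  qed
  ultimately show ?thesis
    using T(1) by (meson finite_SigmaI finite_surj)
qed

end

section \<open>Automorphism groups of connected locally finite graphs\<close>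

lemma fst_mult_graph_Aut: "fst (g \<otimes>\<^bsub>graph_Aut X r\<^esub> h) = fst g \<circ> fst h"
  by (simp add: graph_Aut_def case_prod_beta)

lemma snd_mult_graph_Aut: "snd (g \<otimes>\<^bsub>graph_Aut X r\<^esub> h) = snd g \<circ> snd h"
  by (simp add: graph_Aut_def case_prod_beta)

lemma one_graph_Aut: "\<one>\<^bsub>graph_Aut X r\<^esub> = (id, id)"
  by (simp add: graph_Aut_def)

context bidirected_digraph
begin

abbreviation "Aut \<equiv> graph_Aut G arev"

lemma Aut_verts: "k \<in> carrier Aut \<Longrightarrow> v \<in> verts G \<Longrightarrow> fst k v \<in> verts G"
  by (auto simp: graph_Aut_def permutes_in_image)

lemma Aut_arcs: "k \<in> carrier Aut \<Longrightarrow> e \<in> arcs G \<Longrightarrow> snd k e \<in> arcs G"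
  by (auto simp: graph_Aut_def permutes_in_image)

lemma Aut_tail: "k \<in> carrier Aut \<Longrightarrow> e \<in> arcs G \<Longrightarrow> tail G (snd k e) = fst k (tail G e)"
  by (auto simp: graph_Aut_def)

lemma Aut_head: "k \<in> carrier Aut \<Longrightarrow> e \<in> arcs G \<Longrightarrow> head G (snd k e) = fst k (head G e)"
  by (auto simp: graph_Aut_def)

lemma Aut_outside: "k \<in> carrier Aut \<Longrightarrow> v \<notin> verts G \<Longrightarrow> fst k v = v"
  by (auto simp: graph_Aut_def permutes_not_in)

lemma Aut_inv:
  assumes "k \<in> carrier Aut"
  shows "fst k (fst (inv\<^bsub>Aut\<^esub> k) v) = v" "snd k (snd (inv\<^bsub>Aut\<^esub> k) e) = e"
    "fst (inv\<^bsub>Aut\<^esub> k) (fst k v) = v"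
proof -
  interpret A: group Aut by (rule group_graph_Aut) (rule bidirected_digraph)
  show "fst k (fst (inv\<^bsub>Aut\<^esub> k) v) = v" "snd k (snd (inv\<^bsub>Aut\<^esub> k) e) = e"
    using A.r_inv[OF assms] fst_mult_graph_Aut[of G arev k "inv\<^bsub>Aut\<^esub> k"]
      snd_mult_graph_Aut[of G arev k "inv\<^bsub>Aut\<^esub> k"]
    by (simp_all add: one_graph_Aut fun_eq_iff)
  show "fst (inv\<^bsub>Aut\<^esub> k) (fst k v) = v"
    using A.l_inv[OF assms] fst_mult_graph_Aut[of G arev "inv\<^bsub>Aut\<^esub> k" k]
    by (simp add: one_graph_Aut fun_eq_iff)
qed

text \<open>
  Induction along a path from \<open>x\<close>: the image of a neighbour of \<open>y\<close>
  is a neighbour of one of the finitely many images of \<open>y\<close>.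
\<close>

lemma stabilizer_orbit_finite:
  assumes lf: "locally_finite G" and conn: "Digraph_Component.connected G"
    and x: "x \<in> verts G" "v \<in> verts G"
  shows "finite ((\<lambda>k. fst k v) ` {k \<in> carrier Aut. fst k x = x})"
proof -
  have "x \<rightarrow>\<^sup>*\<^bsub>G\<^esub> v"
    using symmetric_connected_imp_strongly_connected[OF sym_arcs conn] x by auto
  then show ?thesis
  proof (induction rule: reachable_induct)
    case base
    have "(\<lambda>k. fst k x) ` {k \<in> carrier Aut. fst k x = x} \<subseteq> {x}" by auto
    then show ?case using finite_subset by blast
  next
    case (step y z)
    obtain e where e: "e \<in> arcs G" "tail G e = y" "head G e = z" using step(2) by blast
    have "(\<lambda>k. fst k z) ` {k \<in> carrier Aut. fst k x = x} \<subseteq>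
      head G ` (\<Union>w\<in>(\<lambda>k. fst k y) ` {k \<in> carrier Aut. fst k x = x}. out_arcs G w)"
    proof
      fix w assume "w \<in> (\<lambda>k. fst k z) ` {k \<in> carrier Aut. fst k x = x}"
      then obtain k where k: "k \<in> carrier Aut" "fst k x = x" "w = fst k z" by blast
      have "snd k e \<in> out_arcs G (fst k y)" "w = head G (snd k e)"
        using k e Aut_arcs Aut_tail Aut_head by (auto simp: out_arcs_def)
      then show "w \<in> head G ` (\<Union>w\<in>(\<lambda>k. fst k y) ` {k \<in> carrier Aut. fst k x = x}. out_arcs G w)"
        using k by blast
    qed
    moreover have "finite (out_arcs G w)" if "w \<in> (\<lambda>k. fst k y) ` {k \<in> carrier Aut. fst k x = x}" for w
      using that lf Aut_verts e(1,2) tail_in_verts unfolding locally_finite_def by blast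
    ultimately show ?case using step.IH by (meson finite_UN_I finite_imageI finite_subset)
  qed
qed

text \<open>
  The vertex map determines the ends of the image of an arc, and without multiple arcs these
  determine the image.
\<close>

lemma Aut_eqI:
  assumes nm: "nomulti_digraph G" and k: "k \<in> carrier Aut" "k' \<in> carrier Aut"
    and eq: "\<And>v. v \<in> verts G \<Longrightarrow> fst k v = fst k' v"
  shows "k = k'"
proof (rule prod_eqI)
  show "fst k = fst k'"
  proof
    fix v show "fst k v = fst k' v"
      by (cases "v \<in> verts G") (use eq k Aut_outside in auto)
  qed
  show "snd k = snd k'"
  proof
    fix e show "snd k e = snd k' e"
    proof (cases "e \<in> arcs G")
      case True
      then have "arc_to_ends G (snd k e) = arc_to_ends G (snd k' e)"
        using k eq by (simp add: arc_to_ends_def Aut_tail Aut_head)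
      then show ?thesis
        using nomulti_digraph.no_multi_arcs[OF nm] Aut_arcs k True by blast
    next
      case False
      then show ?thesis using k by (auto simp: graph_Aut_def permutes_not_in)
    qed
  qed
qed

lemma topspace_Aut: "topspace (Aut_topology G arev) = carrier Aut"
  by (auto simp: Aut_topology_def)

text \<open>
  A basic neighbourhood of the identity restricts finitely many vertices and finitely many
  arcs; in a graph without multiple arcs an automorphism fixing both ends of an arc fixes the
  arc.
\<close>

lemma identity_neighbourhood:
  assumes nm: "nomulti_digraph G" and U: "openin (Aut_topology G arev) U" "\<one>\<^bsub>Aut\<^esub> \<in> U"
  obtains B where "finite B" "B \<subseteq> verts G"
    "\<And>k. k \<in> carrier Aut \<Longrightarrow> (\<And>v. v \<in> B \<Longrightarrow> fst k v = v) \<Longrightarrow> k \<in> U"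
proof -
  obtain W where W: "openin (prod_topology (product_topology (\<lambda>_. discrete_topology UNIV) UNIV)
                      (product_topology (\<lambda>_. discrete_topology UNIV) UNIV)) W" "U = W \<inter> carrier Aut"
    using U(1) unfolding Aut_topology_def openin_subtopology by blast
  have idW: "(id, id) \<in> W" using U(2) W(2) by (simp add: one_graph_Aut)
  obtain P Q where P: "openin (product_topology (\<lambda>_. discrete_topology UNIV) UNIV) P"
      and Q: "openin (product_topology (\<lambda>_. discrete_topology UNIV) UNIV) Q"
      and PQ: "id \<in> P" "id \<in> Q" "P \<times> Q \<subseteq> W"
    using W(1)[unfolded openin_prod_topology_alt, THEN spec, THEN spec, THEN mp, OF idW] by blast
  obtain p where p: "finite {i. p i \<noteq> UNIV}" "id \<in> PiE UNIV p" "PiE UNIV p \<subseteq> P"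
    using P[unfolded openin_product_topology_alt, THEN bspec, OF PQ(1)] by auto
  obtain q where q: "finite {i. q i \<noteq> UNIV}" "id \<in> PiE UNIV q" "PiE UNIV q \<subseteq> Q"
    using Q[unfolded openin_product_topology_alt, THEN bspec, OF PQ(2)] by auto
  define A where "A = {i. q i \<noteq> UNIV} \<inter> arcs G"
  define B where "B = ({i. p i \<noteq> UNIV} \<inter> verts G) \<union> tail G ` A \<union> head G ` A"
  have "k \<in> U" if k: "k \<in> carrier Aut" and fixB: "\<And>v. v \<in> B \<Longrightarrow> fst k v = v" for k
  proof -
    have "fst k i \<in> p i" for i
    proof (cases "p i = UNIV")
      case False
      then have "fst k i = i"
        using fixB Aut_outside[OF k] unfolding B_def by blast
      then show ?thesis using p(2) by (auto simp: PiE_def Pi_def)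
    qed simp
    then have "fst k \<in> P" using p(3) by (auto simp: PiE_def Pi_def)
    have "snd k e \<in> q e" for e
    proof (cases "q e = UNIV")
      case False
      have "snd k e = e"
      proof (cases "e \<in> arcs G")
        case True
        then have "e \<in> A" using False unfolding A_def by simp
        then have "arc_to_ends G (snd k e) = arc_to_ends G e"
          using fixB k True unfolding B_def by (auto simp: arc_to_ends_def Aut_tail Aut_head)
        then show ?thesis
          using nomulti_digraph.no_multi_arcs[OF nm] Aut_arcs k True by blast
      next
        case False
        then show ?thesis using k by (auto simp: graph_Aut_def permutes_not_in)
      qed
      then show ?thesis using q(2) by (auto simp: PiE_def Pi_def)
    qed simp
    then have "snd k \<in> Q" using q(3) by (auto simp: PiE_def Pi_def)
    with \<open>fst k \<in> P\<close> have "k \<in> W" using PQ(3) by (cases k) auto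
    then show ?thesis using W(2) k by simp
  qed
  moreover have "finite B" "B \<subseteq> verts G"
    unfolding B_def A_def using p(1) q(1) by auto
  ultimately show thesis using that by blast
qed

text \<open>
  Evaluation at \<open>x\<close> is continuous with discrete range, and compact subsets of a
  discrete space are finite.
\<close>

lemma compact_orbit_finite:
  assumes "compactin (Aut_topology G arev) N"
  shows "finite ((\<lambda>k. fst k x) ` N)"
proof -
  have "continuous_map (Aut_topology G arev) (discrete_topology UNIV) ((\<lambda>f. f x) \<circ> fst)"
    unfolding Aut_topology_def
    by (intro continuous_map_from_subtopology continuous_map_compose[of _ "product_topology (\<lambda>_. discrete_topology UNIV) UNIV"]
        continuous_map_fst continuous_map_product_projection) simp_all
  then have "compactin (discrete_topology UNIV) (((\<lambda>f. f x) \<circ> fst) ` N)"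
    using assms image_compactin by blast
  then show ?thesis by (simp add: compactin_discrete_topology image_comp comp_def)
qed

text \<open>
  The kernel is open as the preimage of a point of the discrete quotient.
\<close>

lemma compact_by_discrete_open_kernel:
  assumes "compact_by_discrete Aut (Aut_topology G arev)"
  obtains N where "N \<lhd> Aut" "compactin (Aut_topology G arev) N" "openin (Aut_topology G arev) N"
proof -
  interpret A: group Aut by (rule group_graph_Aut) (rule bidirected_digraph)
  obtain N where N: "N \<lhd> Aut" "compactin (Aut_topology G arev) N"
    and q: "quotient_map (Aut_topology G arev) (discrete_topology (carrier (Aut Mod N))) (\<lambda>g. N #>\<^bsub>Aut\<^esub> g)"
    using assms unfolding compact_by_discrete_def by blast
  interpret N: normal N Aut by (rule N(1))
  have "N \<in> carrier (Aut Mod N)"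
    using N.subgroup_in_rcosets[OF A.group_axioms] by (simp add: FactGroup_def)
  then have "openin (discrete_topology (carrier (Aut Mod N))) {N}" by simp
  then have "openin (Aut_topology G arev) {g \<in> carrier Aut. N #>\<^bsub>Aut\<^esub> g \<in> {N}}"
    unfolding topspace_Aut[symmetric]
    by (rule openin_continuous_map_preimage[OF quotient_imp_continuous_map[OF q]])
  moreover have "{g \<in> carrier Aut. N #>\<^bsub>Aut\<^esub> g \<in> {N}} = N"
    using A.coset_join1[OF _ _ N.subgroup_axioms] A.coset_join2[OF _ N.subgroup_axioms] N.subset
    by auto
  ultimately show thesis using that N by simp
qed

text \<open>
  If \<open>J\<close> were discrete, some finite set \<open>B\<close> of vertices would have
  trivial pointwise stabiliser in \<open>J\<close>. An element of \<open>J\<close> would then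
  be determined by its values on \<open>B\<close>, which range over finite orbits.
\<close>

lemma infinite_stabilizer_not_discrete:
  assumes nm: "nomulti_digraph G" and lf: "locally_finite G" and conn: "Digraph_Component.connected G"
    and x: "x \<in> verts G"
    and J: "subgroup J Aut" "\<And>k. k \<in> J \<Longrightarrow> fst k x = x" "infinite J"
  shows "\<not> discrete_subset (Aut_topology G arev) J"
proof
  interpret A: group Aut by (rule group_graph_Aut) (rule bidirected_digraph)
  assume "discrete_subset (Aut_topology G arev) J"
  moreover have "openin (discrete_topology J) {\<one>\<^bsub>Aut\<^esub>}"
    using subgroup.one_closed[OF J(1)] by simp
  ultimately have "openin (subtopology (Aut_topology G arev) J) {\<one>\<^bsub>Aut\<^esub>}"
    unfolding discrete_subset_def by simp
  then obtain U where U: "openin (Aut_topology G arev) U" "{\<one>\<^bsub>Aut\<^esub>} = U \<inter> J"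
    unfolding openin_subtopology by blast
  then have "\<one>\<^bsub>Aut\<^esub> \<in> U" by blast
  then obtain B where B: "finite B" "B \<subseteq> verts G"
    "\<And>k. k \<in> carrier Aut \<Longrightarrow> (\<And>v. v \<in> B \<Longrightarrow> fst k v = v) \<Longrightarrow> k \<in> U"
    using identity_neighbourhood[OF nm U(1)] by blast
  have Jc: "J \<subseteq> carrier Aut" using J(1) by (rule subgroup.subset)
  define f where "f k = (\<lambda>v\<in>B. fst k v)" for k :: "('a \<Rightarrow> 'a) \<times> ('b \<Rightarrow> 'b)"
  have "f ` J \<subseteq> PiE B (\<lambda>v. (\<lambda>k. fst k v) ` {k \<in> carrier Aut. fst k x = x})"
  proof (intro image_subsetI)
    fix k assume "k \<in> J"
    then have "k \<in> {k \<in> carrier Aut. fst k x = x}" using Jc J(2) by blast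
    then show "f k \<in> PiE B (\<lambda>v. (\<lambda>k. fst k v) ` {k \<in> carrier Aut. fst k x = x})"
      unfolding f_def by (intro restrict_PiE_iff[THEN iffD2]) blast
  qed
  then have "finite (f ` J)"
    using B(1,2) stabilizer_orbit_finite[OF lf conn x] by (meson finite_PiE finite_subset subsetD)
  moreover have "inj_on f J"
  proof (rule inj_onI)
    fix k k' assume k: "k \<in> J" "k' \<in> J" and f: "f k = f k'"
    have c: "k \<in> carrier Aut" "k' \<in> carrier Aut" using k Jc by auto
    let ?l = "inv\<^bsub>Aut\<^esub> k \<otimes>\<^bsub>Aut\<^esub> k'"
    have l: "?l \<in> J" using k J(1) by (meson subgroup.m_closed subgroup.m_inv_closed)
    have "fst ?l v = v" if "v \<in> B" for v
    proof -
      have "fst k' v = fst k v" using fun_cong[OF f, of v] that by (simp add: f_def)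
      then show ?thesis using Aut_inv(3)[OF c(1)] by (simp add: fst_mult_graph_Aut)
    qed
    then have "?l \<in> U" using B(3) l Jc by blast
    then have "?l = \<one>\<^bsub>Aut\<^esub>" using U(2) l by blast
    then show "k = k'" using c
      by (metis A.inv_closed A.inv_equality A.inv_inv)
  qed
  ultimately show False using J(3) finite_imageD by blast
qed

end

section \<open>The action on the geometric realization\<close>

lemma realization_map_mult:
  "realization_map (g \<otimes>\<^bsub>graph_Aut X r\<^esub> h) p = realization_map g (realization_map h p)"
  unfolding realization_map_def image_image
  by (intro image_cong refl) (auto simp: graph_Aut_def case_prod_beta map_sum.compositionality map_prod.compositionality comp_def id_def)

context bidirected_digraph
begin

lemma edge_point_in_realization:
  assumes "e \<in> arcs G" "t \<in> {0..1}"
  shows "edge_point G arev e t \<in> realization G arev"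
  using assms unfolding realization_def by blast

lemma realization_map_vertex: "realization_map k {Inl v} = {Inl (fst k v)}"
  by (simp add: realization_map_def)

lemma realization_cases:
  assumes "p \<in> realization G arev"
  obtains v where "v \<in> verts G" "p = {Inl v}"
  | e t where "e \<in> arcs G" "t \<in> {0..1}" "p = edge_point G arev e t"
  using assms unfolding realization_def by blast

lemma realization_map_in_realization:
  assumes k: "k \<in> carrier Aut" and p: "p \<in> realization G arev"
  shows "realization_map k p \<in> realization G arev"
  using p
proof (cases rule: realization_cases)
  case (1 v)
  then show ?thesis
    using k by (auto simp: realization_map_vertex realization_def graph_Aut_def permutes_in_image)
next
  case (2 e t)
  then show ?thesis
    using k by (auto simp: realization_map_edge_point graph_Aut_def permutes_in_image
        intro!: edge_point_in_realization)
qed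

lemma path_length_realization_map:
  assumes k: "k \<in> carrier Aut" and "path_length G arev p l q"
  shows "path_length G arev (realization_map k p) l (realization_map k q)"
  using assms(2)
proof (induction rule: path_length.induct)
  case (refl p)
  then show ?case using k by (intro path_length.refl realization_map_in_realization)
next
  case (step p l e s t)
  then show ?case
    using k path_length.step[of G arev "realization_map k p" l "snd k e" s t]
    by (auto simp: realization_map_edge_point graph_Aut_def permutes_in_image)
qed

text \<open>
  An automorphism and its inverse carry paths to paths of the same length.
\<close>

lemma realization_dist_invariant:
  assumes k: "k \<in> carrier Aut"
  shows "realization_dist G arev (realization_map k p) (realization_map k q) =
    realization_dist G arev p q"
proof -
  interpret A: group Aut by (rule group_graph_Aut) (rule bidirected_digraph)
  let ?k = "inv\<^bsub>Aut\<^esub> k"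
  have "realization_map \<one>\<^bsub>Aut\<^esub> p = p" for p :: "('a + 'b \<times> real) set"
    by (simp add: realization_map_def graph_Aut_def map_sum.id map_prod.id)
  then have "realization_map ?k (realization_map k p) = p" for p :: "('a + 'b \<times> real) set"
    using k realization_map_mult[of G arev ?k k] by simp
  then have "path_length G arev (realization_map k p) l (realization_map k q) \<longleftrightarrow>
      path_length G arev p l q" for l
    using path_length_realization_map[OF k] path_length_realization_map[of ?k] k
    by (metis A.inv_closed)
  then show ?thesis by (simp add: realization_dist_def)
qed

lemma topspace_realization: "topspace (realization_topology G arev) = realization G arev"
proof -
  have "openin (realization_topology G arev) (realization G arev)"
    unfolding openin_realization_topology
  proof (intro conjI ballI)
    fix e assume "e \<in> arcs G"
    then have "{t \<in> {0..1}. edge_point G arev e t \<in> realization G arev} = {0..1}"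
      using edge_point_in_realization by blast
    then show "openin (top_of_set {0..1}) {t \<in> {0..1}. edge_point G arev e t \<in> realization G arev}"
      by simp
  qed simp
  then show ?thesis
    by (metis openin_realization_topology openin_subset openin_topspace subset_antisym)
qed

text \<open>
  Open stars of vertices form an open cover of the realization that is permuted by
  automorphisms and in which two members meet only if their centres are equal or adjacent.
  They reduce compactness questions to finite sets of vertices.
\<close>

definition open_star :: "'a \<Rightarrow> ('a + 'b \<times> real) set set" where
  "open_star v = insert {Inl v} {edge_point G arev e t | e t. e \<in> arcs G \<and> tail G e = v \<and> t \<in> {0..<1}}"

lemma edge_point_in_open_star_iff:
  assumes "e \<in> arcs G" "t \<in> {0..1}"
  shows "edge_point G arev e t \<in> open_star v \<longleftrightarrow> tail G e = v \<and> t < 1 \<or> head G e = v \<and> t > 0"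
proof
  assume "edge_point G arev e t \<in> open_star v"
  then consider "edge_point G arev e t = {Inl v}"
    | e' t' where "e' \<in> arcs G" "tail G e' = v" "0 \<le> t'" "t' < 1"
      "edge_point G arev e t = edge_point G arev e' t'"
    unfolding open_star_def by auto
  then show "tail G e = v \<and> t < 1 \<or> head G e = v \<and> t > 0"
  proof cases
    case 1
    then show ?thesis using assms by (auto simp: edge_point_def split: if_splits)
  next
    case 2
    show ?thesis
    proof (cases "t = 0 \<or> t = 1")
      case True
      then show ?thesis using 2 by (auto simp: edge_point_def split: if_splits)
    next
      case False
      then have "(e', t') = (e, t) \<or> (e', t') = (arev e, 1 - t)"
        using 2(3-5) by (auto simp: edge_point_def doubleton_eq_iff split: if_splits)
      then show ?thesis using False 2(2) assms by auto
    qed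
  qed
next
  assume *: "tail G e = v \<and> t < 1 \<or> head G e = v \<and> t > 0"
  show "edge_point G arev e t \<in> open_star v"
  proof (cases "tail G e = v \<and> t < 1")
    case True
    then show ?thesis using assms unfolding open_star_def by auto
  next
    case False
    with * have h: "head G e = v" "t > 0" by auto
    have "edge_point G arev e t = edge_point G arev (arev e) (1 - t)"
      using assms h by (auto simp: edge_point_def)
    moreover have "arev e \<in> arcs G" "tail G (arev e) = v" "1 - t \<in> {0..<1}"
      using assms h by auto
    ultimately show ?thesis unfolding open_star_def by blast
  qed
qed

lemma open_star_subset: "v \<in> verts G \<Longrightarrow> open_star v \<subseteq> realization G arev"
  unfolding open_star_def realization_def by (auto intro: less_imp_le)

text \<open>
  On an arc the star is a union of half-open intervals, one for each end of the arc that
  equals \<open>v\<close>; a loop at \<open>v\<close> contributes both.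
\<close>

lemma openin_open_star:
  assumes "v \<in> verts G"
  shows "openin (realization_topology G arev) (open_star v)"
  unfolding openin_realization_topology
proof (intro conjI ballI)
  show "open_star v \<subseteq> realization G arev" using assms by (rule open_star_subset)
  fix e assume e: "e \<in> arcs G"
  let ?U = "(if tail G e = v then {..<1} else {}) \<union> (if head G e = v then {0<..} else {}) :: real set"
  have "{t \<in> {0..1}. edge_point G arev e t \<in> open_star v} = {0..1} \<inter> ?U"
    using edge_point_in_open_star_iff[OF e] by auto
  moreover have "open ?U" by auto
  ultimately show "openin (top_of_set {0..1}) {t \<in> {0..1}. edge_point G arev e t \<in> open_star v}"
    by (simp only: openin_open_Int)
qed

lemma realization_open_star_cover:
  assumes "p \<in> realization G arev"
  obtains v where "v \<in> verts G" "p \<in> open_star v"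
  using assms
proof (cases rule: realization_cases)
  case (1 v)
  then show ?thesis using that unfolding open_star_def by blast
next
  case (2 e t)
  then show ?thesis
    using that[of "tail G e"] that[of "head G e"] edge_point_in_open_star_iff[OF 2(1,2)]
    by (cases "t < 1") auto
qed

lemma open_star_intersect:
  assumes "p \<in> open_star v" "p \<in> open_star w"
  shows "w \<in> insert v (head G ` out_arcs G v)"
proof -
  consider "p = {Inl v}"
    | e t where "e \<in> arcs G" "tail G e = v" "0 \<le> t" "t < 1" "p = edge_point G arev e t"
    using assms(1) unfolding open_star_def by auto
  then show ?thesis
  proof cases
    case 1
    then show ?thesis using assms(2)
      unfolding open_star_def by (auto simp: edge_point_def split: if_splits)
  next
    case 2
    then have "tail G e = w \<or> head G e = w"
      using edge_point_in_open_star_iff[of e t w] assms(2) by auto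
    then show ?thesis using 2 by (auto simp: out_arcs_def)
  qed
qed

lemma realization_map_open_star:
  assumes k: "k \<in> carrier Aut" and p: "p \<in> open_star v"
  shows "realization_map k p \<in> open_star (fst k v)"
proof -
  consider "p = {Inl v}"
    | e t where "e \<in> arcs G" "tail G e = v" "t \<in> {0..<1}" "p = edge_point G arev e t"
    using p unfolding open_star_def by auto
  then show ?thesis
  proof cases
    case 1
    then show ?thesis by (simp add: realization_map_vertex open_star_def)
  next
    case 2
    then have "snd k e \<in> arcs G" "tail G (snd k e) = fst k v"
      using k by (auto simp: graph_Aut_def permutes_in_image)
    then show ?thesis
      using 2 realization_map_edge_point[OF k 2(1)] unfolding open_star_def by auto
  qed
qed

lemma compact_in_finitely_many_stars:
  assumes "compactin (realization_topology G arev) C"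
  obtains V where "finite V" "V \<subseteq> verts G" "C \<subseteq> (\<Union>v\<in>V. open_star v)"
proof -
  have "C \<subseteq> \<Union> (open_star ` verts G)"
  proof
    fix p assume "p \<in> C"
    then have "p \<in> realization G arev"
      using compactin_subset_topspace[OF assms] topspace_realization by blast
    then show "p \<in> \<Union> (open_star ` verts G)" by (rule realization_open_star_cover) blast
  qed
  then obtain F where F: "finite F" "F \<subseteq> open_star ` verts G" "C \<subseteq> \<Union>F"
    using compactinD[OF assms, of "open_star ` verts G"] openin_open_star by blast
  obtain V where "V \<subseteq> verts G" "finite V" "F = open_star ` V"
    using finite_subset_image[OF F(1,2)] by blast
  with F(3) that show thesis by blast
qed

lemma compactin_edge:
  assumes "e \<in> arcs G"
  shows "compactin (realization_topology G arev) (edge_point G arev e ` {0..1})"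
proof (rule image_compactin)
  show "compactin (top_of_set {0..1::real}) {0..1}"
    by (simp add: compactin_subtopology)
  show "continuous_map (top_of_set {0..1}) (realization_topology G arev) (edge_point G arev e)"
    unfolding continuous_map_def topspace_realization
    using assms by (auto simp: openin_realization_topology edge_point_in_realization)
qed

text \<open>
  A compact set lies in finitely many open stars, so a group element moving it to meet itself
  moves one of finitely many vertices into a finite set; on a simply transitive orbit this
  leaves finitely many group elements. The closed star of \<open>x\<close> is a compact set
  whose translates cover.
\<close>

theorem geometric_actionI:
  assumes grp: "group H" and hom: "\<phi> \<in> hom H Aut"
    and lf: "locally_finite G" and x: "x \<in> verts G"
    and st: "bij_betw (\<lambda>g. fst (\<phi> g) x) (carrier H) (verts G)"
  shows "geometric_action H G arev \<phi>"
proof -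
  interpret A: group Aut by (rule group_graph_Aut) (rule bidirected_digraph)
  interpret H: group H by (rule grp)
  have \<phi>: "\<phi> g \<in> carrier Aut" if "g \<in> carrier H" for g
    using hom that by (auto simp: hom_def)
  have mult: "fst (\<phi> (g \<otimes>\<^bsub>H\<^esub> h)) v = fst (\<phi> g) (fst (\<phi> h) v)"
    if "g \<in> carrier H" "h \<in> carrier H" for g h v
    using hom that by (simp add: hom_def graph_Aut_def case_prod_beta)
  have inj: "inj_on (\<lambda>g. fst (\<phi> g) v) (carrier H)" if v: "v \<in> verts G" for v
  proof (rule inj_onI)
    obtain h where h: "h \<in> carrier H" "v = fst (\<phi> h) x"
      using st v unfolding bij_betw_def by blast
    fix g g' assume g: "g \<in> carrier H" "g' \<in> carrier H" and eq: "fst (\<phi> g) v = fst (\<phi> g') v"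
    then have "fst (\<phi> (g \<otimes>\<^bsub>H\<^esub> h)) x = fst (\<phi> (g' \<otimes>\<^bsub>H\<^esub> h)) x"
      using h mult by simp
    then have "g \<otimes>\<^bsub>H\<^esub> h = g' \<otimes>\<^bsub>H\<^esub> h"
      using st g h(1) unfolding bij_betw_def inj_on_def by simp
    then show "g = g'" using g h(1) by simp
  qed
  have proper: "finite {g \<in> carrier H. realization_map (\<phi> g) ` C \<inter> C \<noteq> {}}"
    if C: "compactin (realization_topology G arev) C" for C
  proof -
    obtain V where V: "finite V" "V \<subseteq> verts G" "C \<subseteq> (\<Union>v\<in>V. open_star v)"
      using compact_in_finitely_many_stars[OF C] by blast
    define N where "N = (\<Union>w\<in>V. insert w (head G ` out_arcs G w))"
    have "finite N" unfolding N_def using V lf by (auto simp: locally_finite_def)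
    then have "finite (\<Union>v\<in>V. (\<lambda>g. fst (\<phi> g) v) -` N \<inter> carrier H)"
      using V inj by (intro finite_UN_I finite_vimage_IntI) auto
    moreover have "{g \<in> carrier H. realization_map (\<phi> g) ` C \<inter> C \<noteq> {}} \<subseteq>
        (\<Union>v\<in>V. (\<lambda>g. fst (\<phi> g) v) -` N \<inter> carrier H)"
    proof
      fix g assume "g \<in> {g \<in> carrier H. realization_map (\<phi> g) ` C \<inter> C \<noteq> {}}"
      then obtain p where g: "g \<in> carrier H" and p: "p \<in> C" "realization_map (\<phi> g) p \<in> C"
        by blast
      obtain v w where v: "v \<in> V" "p \<in> open_star v"
        and w: "w \<in> V" "realization_map (\<phi> g) p \<in> open_star w"
        using V(3) p by blast
      have "fst (\<phi> g) v \<in> N"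
        using open_star_intersect[OF w(2) realization_map_open_star[OF \<phi>[OF g] v(2)]] w(1)
        unfolding N_def by blast
      then show "g \<in> (\<Union>v\<in>V. (\<lambda>g. fst (\<phi> g) v) -` N \<inter> carrier H)"
        using g v(1) by blast
    qed
    ultimately show ?thesis using finite_subset by blast
  qed
  \<comment> \<open>The closed star of \<open>x\<close>; the vertex is inserted for the case that it has no arcs.\<close>
  define C where "C = insert {Inl x} (\<Union>e\<in>out_arcs G x. edge_point G arev e ` {0..1})"
  have "compactin (realization_topology G arev) (\<Union>e\<in>out_arcs G x. edge_point G arev e ` {0..1})"
    using lf x by (intro compactin_Union) (auto simp: locally_finite_def compactin_edge)
  moreover have "compactin (realization_topology G arev) {{Inl x}}"
    using x by (intro finite_imp_compactin) (auto simp: topspace_realization realization_def)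
  ultimately have C: "compactin (realization_topology G arev) C"
    unfolding C_def using compactin_Un by (metis insert_is_Un)
  have "C \<subseteq> realization G arev"
    using compactin_subset_topspace[OF C] topspace_realization by simp
  then have "(\<Union>g\<in>carrier H. realization_map (\<phi> g) ` C) \<subseteq> realization G arev"
    using \<phi> realization_map_in_realization by blast
  moreover have "p \<in> (\<Union>g\<in>carrier H. realization_map (\<phi> g) ` C)"
    if p: "p \<in> realization G arev" for p
    using p
  proof (cases rule: realization_cases)
    case (1 v)
    then obtain g where "g \<in> carrier H" "v = fst (\<phi> g) x"
      using st unfolding bij_betw_def by blast
    then show ?thesis
      using 1 realization_map_vertex[of "\<phi> g" x] unfolding C_def by blast
  next
    case (2 e t)
    obtain g where g: "g \<in> carrier H" "tail G e = fst (\<phi> g) x"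
      using st 2(1) tail_in_verts unfolding bij_betw_def by blast
    let ?k = "inv\<^bsub>Aut\<^esub> (\<phi> g)"
    have k: "?k \<in> carrier Aut" using \<phi>[OF g(1)] by simp
    have "(fst ?k \<circ> fst (\<phi> g), snd (\<phi> g) \<circ> snd ?k) = (id, id)"
      using A.l_inv[OF \<phi>[OF g(1)]] A.r_inv[OF \<phi>[OF g(1)]]
      by (simp add: graph_Aut_def case_prod_beta prod_eq_iff)
    then have i: "fst ?k (fst (\<phi> g) v) = v" "snd (\<phi> g) (snd ?k a) = a" for v a
      by (auto simp: fun_eq_iff)
    have e': "snd ?k e \<in> arcs G" "tail G (snd ?k e) = x"
      using k 2(1) i g(2) by (auto simp: graph_Aut_def permutes_in_image)
    then have "edge_point G arev (snd ?k e) t \<in> C"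
      using 2(2) unfolding C_def by (auto simp: out_arcs_def)
    moreover have "realization_map (\<phi> g) (edge_point G arev (snd ?k e) t) = p"
      using realization_map_edge_point[OF \<phi>[OF g(1)] e'(1)] i 2(3) by simp
    ultimately show ?thesis using g(1) by blast
  qed
  ultimately have "(\<Union>g\<in>carrier H. realization_map (\<phi> g) ` C) = realization G arev" by blast
  then show ?thesis
    unfolding geometric_action_def
    by (intro conjI ballI allI impI exI[of _ C] hom C proper realization_dist_invariant \<phi>)
qed

end

section \<open>Commensurating vertex stabilisers\<close>

context bidirected_digraph
begin

text \<open>
  The graph-theoretic form of the whole argument: it remains to exhibit a graph with a simply
  transitive action and finitely many automorphisms fixing a vertex that exchange with the
  action and generate an infinite group.
\<close>

theorem commensurated_action:
  assumes nm: "nomulti_digraph G" and lf: "locally_finite G" and conn: "Digraph_Component.connected G"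
    and x: "x \<in> verts G"
    and H: "group H" and hom: "\<phi> \<in> hom H Aut"
    and st: "bij_betw (\<lambda>h. fst (\<phi> h) x) (carrier H) (verts G)"
    and S: "finite S" "S \<subseteq> carrier Aut" "\<And>s. s \<in> S \<Longrightarrow> inv\<^bsub>Aut\<^esub> s \<in> S" "\<And>s. s \<in> S \<Longrightarrow> fst s x = x"
    and ex: "\<And>h s. h \<in> carrier H \<Longrightarrow> s \<in> S \<Longrightarrow> \<exists>s'\<in>S. \<exists>h'\<in>carrier H.
      \<forall>v\<in>verts G. fst (\<phi> h) (fst s v) = fst s' (fst (\<phi> h') v)"
    and inf: "infinite (generate Aut S)"
  shows "inj_on \<phi> (carrier H) \<and> geometric_action H G arev \<phi> \<and>
    (\<exists>x\<in>verts G. \<exists>J.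
       fin_gen_subgroup J Aut \<and>
       J \<subseteq> commensurator Aut (\<phi> ` carrier H) \<inter> stabilizer Aut fst x \<and>
       \<not> discrete_subset (Aut_topology G arev) J) \<and>
    \<not> compact_by_discrete Aut (Aut_topology G arev)"
proof (intro conjI)
  interpret A: group Aut by (rule group_graph_Aut) (rule bidirected_digraph)
  interpret H: group H by (rule H)
  interpret \<phi>: group_hom H Aut \<phi> by unfold_locales (rule hom)
  have sub: "subgroup (\<phi> ` carrier H) Aut" by (rule \<phi>.img_is_subgroup)
  have exch: "A.exchange (\<phi> ` carrier H) S"
    unfolding A.exchange_def
  proof (intro ballI)
    fix k s assume "k \<in> \<phi> ` carrier H" and s: "s \<in> S"
    then obtain h where h: "h \<in> carrier H" "k = \<phi> h" by blast
    obtain s' h' where s': "s' \<in> S" and h': "h' \<in> carrier H"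
      and eq: "\<And>v. v \<in> verts G \<Longrightarrow> fst (\<phi> h) (fst s v) = fst s' (fst (\<phi> h') v)"
      using ex[OF h(1) s] by blast
    have "k \<otimes>\<^bsub>Aut\<^esub> s = s' \<otimes>\<^bsub>Aut\<^esub> \<phi> h'"
    proof (rule Aut_eqI[OF nm])
      show "k \<otimes>\<^bsub>Aut\<^esub> s \<in> carrier Aut" "s' \<otimes>\<^bsub>Aut\<^esub> \<phi> h' \<in> carrier Aut"
        using h s s' h' S(2) by auto
    qed (use eq h in \<open>simp add: fst_mult_graph_Aut\<close>)
    then show "\<exists>s'\<in>S. \<exists>k'\<in>\<phi> ` carrier H. k \<otimes>\<^bsub>Aut\<^esub> s = s' \<otimes>\<^bsub>Aut\<^esub> k'"
      using s' h' by blast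
  qed
  let ?J = "generate Aut S"
  have J: "subgroup ?J Aut" using S(2) by (rule A.generate_is_subgroup)
  have Jx: "fst k x = x" if "k \<in> ?J" for k
    using that
  proof (induction rule: generate.induct)
    case (eng k1 k2)
    then show ?case by (simp add: fst_mult_graph_Aut)
  qed (use S in \<open>auto simp: one_graph_Aut\<close>)
  show "inj_on \<phi> (carrier H)"
    using st unfolding bij_betw_def inj_on_def by metis
  show "geometric_action H G arev \<phi>"
    using H hom lf x st by (rule geometric_actionI)
  show "\<exists>x\<in>verts G. \<exists>J. fin_gen_subgroup J Aut \<and>
       J \<subseteq> commensurator Aut (\<phi> ` carrier H) \<inter> stabilizer Aut fst x \<and>
       \<not> discrete_subset (Aut_topology G arev) J"
  proof (intro bexI[OF _ x] exI[of _ ?J] conjI)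
    show "fin_gen_subgroup ?J Aut" unfolding fin_gen_subgroup_def using S by blast
    have "?J \<subseteq> commensurator Aut (\<phi> ` carrier H)"
      using sub S(1-3) exch by (rule A.generate_subset_commensurator)
    moreover have "?J \<subseteq> stabilizer Aut fst x"
      unfolding stabilizer_def using Jx subgroup.subset[OF J] by blast
    ultimately show "?J \<subseteq> commensurator Aut (\<phi> ` carrier H) \<inter> stabilizer Aut fst x" by blast
    show "\<not> discrete_subset (Aut_topology G arev) ?J"
      using nm lf conn x J Jx inf by (rule infinite_stabilizer_not_discrete)
  qed
  show "\<not> compact_by_discrete Aut (Aut_topology G arev)"
  proof
    assume "compact_by_discrete Aut (Aut_topology G arev)"
    then obtain N where N: "N \<lhd> Aut" "compactin (Aut_topology G arev) N"
      "openin (Aut_topology G arev) N"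
      by (rule compact_by_discrete_open_kernel)
    have "\<one>\<^bsub>Aut\<^esub> \<in> N" using N(1) by (simp add: normal.axioms(1) subgroup.one_closed)
    then obtain B where B: "finite B" "B \<subseteq> verts G"
      "\<And>k. k \<in> carrier Aut \<Longrightarrow> (\<And>v. v \<in> B \<Longrightarrow> fst k v = v) \<Longrightarrow> k \<in> N"
      using identity_neighbourhood[OF nm N(3)] by blast
    have "finite ?J"
    proof (rule A.finite_generate_if_compact_open_normal[where act = fst and V = "verts G" and x = x, OF sub])
      show "fst \<one>\<^bsub>Aut\<^esub> = id" by (simp add: one_graph_Aut)
      show "fst (g \<otimes>\<^bsub>Aut\<^esub> h) = fst g \<circ> fst h" for g h by (rule fst_mult_graph_Aut)
      show "g = h" if "g \<in> carrier Aut" "h \<in> carrier Aut" "\<And>v. v \<in> verts G \<Longrightarrow> fst g v = fst h v" for g h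
        using nm that by (rule Aut_eqI)
      have "(\<lambda>k. fst k x) ` \<phi> ` carrier H = verts G"
        using st unfolding bij_betw_def by (simp add: image_image)
      moreover have "inj_on (\<lambda>k. fst k x) (\<phi> ` carrier H)"
        using st unfolding bij_betw_def inj_on_def by auto
      ultimately show "bij_betw (\<lambda>k. fst k x) (\<phi> ` carrier H) (verts G)"
        unfolding bij_betw_def by blast
      show "finite ((\<lambda>k. fst k v) ` {k \<in> carrier Aut. fst k x = x})" if "v \<in> verts G" for v
        using lf conn x that by (rule stabilizer_orbit_finite)
      show "finite ((\<lambda>n. fst n x) ` N)" using N(2) by (rule compact_orbit_finite)
    qed (fact S exch N(1) B)+
    with inf show False by blast
  qed
qed

end

section \<open>Simple graphs on the natural numbers\<close>

text \<open>
  Arcs are coded ordered pairs, so that vertices and arcs are both natural numbers.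
\<close>

definition nat_graph :: "(nat \<times> nat) set \<Rightarrow> (nat, nat) pre_digraph" where
  "nat_graph E = \<lparr>verts = UNIV, arcs = prod_encode ` E,
     tail = fst \<circ> prod_decode, head = snd \<circ> prod_decode\<rparr>"

definition nat_reverse :: "(nat \<times> nat) set \<Rightarrow> nat \<Rightarrow> nat" where
  "nat_reverse E e = (if e \<in> prod_encode ` E then prod_encode (prod.swap (prod_decode e)) else e)"

definition nat_aut :: "(nat \<times> nat) set \<Rightarrow> (nat \<Rightarrow> nat) \<Rightarrow> (nat \<Rightarrow> nat) \<times> (nat \<Rightarrow> nat)" where
  "nat_aut E s =
     (s, \<lambda>e. if e \<in> prod_encode ` E then prod_encode (map_prod s s (prod_decode e)) else e)"

lemma prod_encode_in_image_iff [simp]: "prod_encode p \<in> prod_encode ` E \<longleftrightarrow> p \<in> E"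
  by (auto simp: prod_encode_eq)

lemma bidirected_nat_graph:
  assumes "sym E" "irrefl E"
  shows "bidirected_digraph (nat_graph E) (nat_reverse E)"
proof -
  interpret wf_digraph "nat_graph E" by unfold_locales (auto simp: nat_graph_def)
  have rev: "nat_reverse E (prod_encode (m, n)) = prod_encode (n, m)" "(n, m) \<in> E" "m \<noteq> n"
    if "(m, n) \<in> E" for m n
    using that assms by (auto simp: nat_reverse_def irrefl_def dest: symD)
  show ?thesis
  proof (rule bidirected_digraphI)
    show "nat_reverse E e = e" if "e \<notin> arcs (nat_graph E)" for e
      using that by (simp add: nat_graph_def nat_reverse_def)
    fix e assume "e \<in> arcs (nat_graph E)"
    then obtain m n where e: "e = prod_encode (m, n)" "(m, n) \<in> E" by (auto simp: nat_graph_def)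
    note r = rev[OF e(2)] rev(1)[OF rev(2)[OF e(2)]]
    show "nat_reverse E e \<noteq> e" "nat_reverse E (nat_reverse E e) = e"
      "tail (nat_graph E) (nat_reverse E e) = head (nat_graph E) e"
      unfolding e(1) r using r(3) by (simp_all add: prod_encode_eq nat_graph_def)
  qed
qed

lemma nomulti_nat_graph: "nomulti_digraph (nat_graph E)"
  by unfold_locales (auto simp: nat_graph_def arc_to_ends_def)

lemma arcs_ends_nat_graph: "arcs_ends (nat_graph E) = E"
  by (force simp: arcs_ends_conv nat_graph_def)

lemma connected_nat_graph:
  assumes "\<And>m n. (m, n) \<in> E\<^sup>*"
  shows "Digraph_Component.connected (nat_graph E)"
proof -
  have "(m, n) \<in> rtrancl_on UNIV (E\<^sup>s)" for m n
    using assms[of m n]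
    by (induction rule: rtrancl_induct) (auto intro: rtrancl_on_into_rtrancl_on simp: symcl_def)
  then show ?thesis
    unfolding connected_conv arcs_ends_nat_graph by (simp add: nat_graph_def)
qed

lemma locally_finite_nat_graph:
  assumes "\<And>m. finite (E `` {m})"
  shows "locally_finite (nat_graph E)"
proof -
  have "out_arcs (nat_graph E) m \<subseteq> (\<lambda>n. prod_encode (m, n)) ` (E `` {m})" for m
    by (auto simp: nat_graph_def out_arcs_def)
  then show ?thesis
    unfolding locally_finite_def using assms by (meson finite_imageI finite_subset)
qed

lemma nat_aut_carrier:
  assumes s: "bij s" and E: "sym E" "\<And>m n. (s m, s n) \<in> E \<longleftrightarrow> (m, n) \<in> E"
  shows "nat_aut E s \<in> carrier (graph_Aut (nat_graph E) (nat_reverse E))"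
proof -
  let ?t = "\<lambda>e. if e \<in> prod_encode ` E then prod_encode (map_prod s s (prod_decode e)) else e"
  have "bij_betw ?t (prod_encode ` E) (prod_encode ` E)"
  proof (rule bij_betwI')
    fix e e' assume "e \<in> prod_encode ` E" "e' \<in> prod_encode ` E"
    then show "(?t e = ?t e') = (e = e')"
      using bij_is_inj[OF s] by (auto simp: prod_encode_eq inj_eq)
  next
    fix e assume "e \<in> prod_encode ` E"
    then show "?t e \<in> prod_encode ` E" using E(2) by (auto simp: prod_encode_eq)
  next
    fix e assume "e \<in> prod_encode ` E"
    then obtain m n where e: "e = prod_encode (m, n)" "(m, n) \<in> E" by auto
    obtain m' n' where "m = s m'" "n = s n'" using s by (metis bij_pointE)
    then show "\<exists>e'\<in>prod_encode ` E. e = ?t e'"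
      using e E(2) by (intro bexI[of _ "prod_encode (m', n')"]) auto
  qed
  then have "?t permutes prod_encode ` E" by (rule bij_imp_permutes) simp
  moreover have "s permutes UNIV" using s by (simp add: permutes_def bij_iff)
  moreover have "?t (nat_reverse E e) = nat_reverse E (?t e)" if mem: "e \<in> prod_encode ` E" for e
  proof -
    obtain m n where e: "e = prod_encode (m, n)" "(m, n) \<in> E" using mem by auto
    have "(n, m) \<in> E" using E(1) e(2) by (rule symD)
    then show ?thesis using e E(2) by (simp add: nat_reverse_def)
  qed
  moreover have "fst (prod_decode (?t e)) = s (fst (prod_decode e)) \<and>
      snd (prod_decode (?t e)) = s (snd (prod_decode e))" if "e \<in> prod_encode ` E" for e
    using that by auto
  ultimately show ?thesis
    unfolding nat_aut_def graph_Aut_def nat_graph_def by simp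
qed

section \<open>Cayley graphs with an exchanging family of maps\<close>

text \<open>
  The maps in \<open>\<Theta>\<close> are permutations of the group that preserve the Cayley
  graph of \<open>D\<close> (\<open>edge\<close>, \<open>edge_back\<close>) and for which
  \<open>\<theta>' (g h) = \<theta> g \<cdot> k\<close> holds for all \<open>g\<close>: right
  translations can be moved past \<open>\<theta>\<close> (\<open>exch\<close>) and past its
  inverse (\<open>exch_back\<close>) at the price of changing both the map and the
  translation. The last assumption says that the maps in \<open>\<Theta>\<close> have
  infinitely many composites.
\<close>

locale exchanging_maps = group G for G (structure) +
  fixes D :: "'a set" and \<Theta> :: "('a \<Rightarrow> 'a) set"
  assumes count: "countable (carrier G)" and inf: "infinite (carrier G)"
    and D: "finite D" "D \<subseteq> carrier G" "\<And>d. d \<in> D \<Longrightarrow> inv d \<in> D" "generate G D = carrier G"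
    and \<Theta>: "finite \<Theta>" "\<And>\<theta>. \<theta> \<in> \<Theta> \<Longrightarrow> bij_betw \<theta> (carrier G) (carrier G)"
      "\<And>\<theta>. \<theta> \<in> \<Theta> \<Longrightarrow> \<theta> \<one> = \<one>"
    and edge: "\<And>\<theta> d g. \<theta> \<in> \<Theta> \<Longrightarrow> d \<in> D \<Longrightarrow> g \<in> carrier G \<Longrightarrow> \<exists>d'\<in>D. \<theta> (d \<otimes> g) = d' \<otimes> \<theta> g"
    and edge_back: "\<And>\<theta> d g. \<theta> \<in> \<Theta> \<Longrightarrow> d \<in> D \<Longrightarrow> g \<in> carrier G \<Longrightarrow> \<exists>d'\<in>D. \<theta> (d' \<otimes> g) = d \<otimes> \<theta> g"
    and exch: "\<And>\<theta> k. \<theta> \<in> \<Theta> \<Longrightarrow> k \<in> carrier G \<Longrightarrow>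
      \<exists>\<theta>'\<in>\<Theta>. \<exists>h\<in>carrier G. \<forall>g\<in>carrier G. \<theta>' (g \<otimes> h) = \<theta> g \<otimes> k"
    and exch_back: "\<And>\<theta> h. \<theta> \<in> \<Theta> \<Longrightarrow> h \<in> carrier G \<Longrightarrow>
      \<exists>\<theta>'\<in>\<Theta>. \<exists>k\<in>carrier G. \<forall>g\<in>carrier G. \<theta>' (g \<otimes> h) = \<theta> g \<otimes> k"
    and inf_\<Theta>: "infinite ((\<lambda>fs. restrict (foldr (\<lambda>f. f) fs) (carrier G)) ` lists \<Theta>)"
begin

definition code :: "'a \<Rightarrow> nat" where "code = to_nat_on (carrier G)"

definition dec :: "nat \<Rightarrow> 'a" where "dec = from_nat_into (carrier G)"

lemma dec_code [simp]: "g \<in> carrier G \<Longrightarrow> dec (code g) = g"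
  unfolding dec_def code_def using count by (rule from_nat_into_to_nat_on)

lemma code_dec [simp]: "code (dec n) = n"
  unfolding dec_def code_def using count inf by (rule to_nat_on_from_nat_into_infinite)

lemma dec_closed [simp]: "dec n \<in> carrier G"
  unfolding dec_def using inf by (intro from_nat_into) auto

lemma dec_eq_iff: "dec m = dec n \<longleftrightarrow> m = n"
  using code_dec by metis

lemma bij_code: "bij_betw code (carrier G) UNIV"
  by (rule bij_betw_byWitness[where f' = dec]) auto

text \<open>
  Edges multiply by generators from the left, so that right translations are automorphisms.
  The condition \<open>m \<noteq> n\<close> discards the loops that trivial generators would
  produce.
\<close>

definition E :: "(nat \<times> nat) set" where
  "E = {(m, n). m \<noteq> n \<and> (\<exists>d\<in>D. dec n = d \<otimes> dec m)}"

lemma sym_E: "sym E"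
proof (rule symI)
  fix m n assume "(m, n) \<in> E"
  then obtain d where d: "d \<in> D" "dec n = d \<otimes> dec m" "m \<noteq> n" unfolding E_def by blast
  have "dec m = inv d \<otimes> dec n"
    using d D(2) by (simp add: subset_eq m_assoc[symmetric])
  then show "(n, m) \<in> E" unfolding E_def using d D(3) by blast
qed

lemma irrefl_E: "irrefl E"
  unfolding E_def irrefl_def by simp

lemma connected_E: "(m, n) \<in> E\<^sup>*"
proof -
  have "(code h, code (g \<otimes> h)) \<in> E\<^sup>*" if "g \<in> generate G D" "h \<in> carrier G" for g h
    using that
  proof (induction arbitrary: h rule: generate.induct)
    case one
    then show ?case by simp
  next
    case (incl d)
    then have "d \<in> carrier G" using D(2) by blast
    then have "code h = code (d \<otimes> h) \<or> (code h, code (d \<otimes> h)) \<in> E"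
      unfolding E_def using incl by auto
    then show ?case by auto
  next
    case (inv d)
    then have "inv d \<in> D" "inv d \<in> carrier G" using D by auto
    then have "code h = code (inv d \<otimes> h) \<or> (code h, code (inv d \<otimes> h)) \<in> E"
      unfolding E_def using inv.prems by auto
    then show ?case by auto
  next
    case (eng g1 g2)
    have c: "g1 \<in> carrier G" "g2 \<in> carrier G" using eng D(4) by auto
    then have "(code h, code (g2 \<otimes> h)) \<in> E\<^sup>*" "(code (g2 \<otimes> h), code (g1 \<otimes> (g2 \<otimes> h))) \<in> E\<^sup>*"
      using eng by auto
    then show ?case using c eng.prems by (simp add: m_assoc)
  qed
  \<comment> \<open>Left multiplication by \<open>dec n (dec m)\<inverse>\<close> leads from \<open>m\<close> to \<open>n\<close>.\<close>
  from this[of "dec n \<otimes> inv (dec m)" "dec m"] show ?thesis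
    by (simp add: D(4) m_assoc)
qed

lemma finite_neighbours: "finite (E `` {m})"
proof -
  have "E `` {m} \<subseteq> (\<lambda>d. code (d \<otimes> dec m)) ` D"
  proof
    fix n assume "n \<in> E `` {m}"
    then obtain d where d: "d \<in> D" "dec n = d \<otimes> dec m" unfolding E_def by auto
    then have "n = code (d \<otimes> dec m)" using code_dec by metis
    then show "n \<in> (\<lambda>d. code (d \<otimes> dec m)) ` D" using d(1) by blast
  qed
  then show ?thesis using D(1) finite_surj by blast
qed

abbreviation "X \<equiv> nat_graph E"
abbreviation "r \<equiv> nat_reverse E"

sublocale X: bidirected_digraph X r
  using sym_E irrefl_E by (rule bidirected_nat_graph)

sublocale Aut: group X.Aut
  by (rule group_graph_Aut) (rule X.bidirected_digraph)

definition lift :: "('a \<Rightarrow> 'a) \<Rightarrow> (nat \<Rightarrow> nat) \<times> (nat \<Rightarrow> nat)" where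
  "lift f = nat_aut E (\<lambda>n. code (f (dec n)))"

lemma fst_lift: "fst (lift f) n = code (f (dec n))"
  by (simp add: lift_def nat_aut_def)

lemma lift_closed:
  assumes f: "bij_betw f (carrier G) (carrier G)"
    and e: "\<And>d g. d \<in> D \<Longrightarrow> g \<in> carrier G \<Longrightarrow> \<exists>d'\<in>D. f (d \<otimes> g) = d' \<otimes> f g"
    and e': "\<And>d g. d \<in> D \<Longrightarrow> g \<in> carrier G \<Longrightarrow> \<exists>d'\<in>D. f (d' \<otimes> g) = d \<otimes> f g"
  shows "lift f \<in> carrier X.Aut"
  unfolding lift_def
proof (rule nat_aut_carrier[OF _ sym_E])
  have fc: "f g \<in> carrier G" if "g \<in> carrier G" for g using f that bij_betwE by blast
  have inj: "f g = f h \<longleftrightarrow> g = h" if "g \<in> carrier G" "h \<in> carrier G" for g h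
    using f that unfolding bij_betw_def inj_on_def by blast
  have "bij_betw dec UNIV (carrier G)"
    by (rule bij_betw_byWitness[where f' = code]) auto
  then have "bij_betw (code \<circ> (f \<circ> dec)) UNIV UNIV"
    using f bij_code by (meson bij_betw_trans)
  then show "bij (\<lambda>n. code (f (dec n)))" by (simp add: comp_def)
  fix m n
  have neq: "code (f (dec m)) \<noteq> code (f (dec n)) \<longleftrightarrow> m \<noteq> n"
    using inj fc dec_closed dec_code dec_eq_iff by metis
  have "(\<exists>d\<in>D. f (dec n) = d \<otimes> f (dec m)) \<longleftrightarrow> (\<exists>d\<in>D. dec n = d \<otimes> dec m)"
  proof
    assume "\<exists>d\<in>D. f (dec n) = d \<otimes> f (dec m)"
    then obtain d where d: "d \<in> D" "f (dec n) = d \<otimes> f (dec m)" by blast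
    obtain d' where d': "d' \<in> D" "f (d' \<otimes> dec m) = d \<otimes> f (dec m)"
      using e'[OF d(1) dec_closed] by blast
    have "d' \<otimes> dec m \<in> carrier G" using d' D(2) by auto
    then have "dec n = d' \<otimes> dec m" using inj[of "dec n" "d' \<otimes> dec m"] d(2) d'(2) by simp
    then show "\<exists>d\<in>D. dec n = d \<otimes> dec m" using d' by blast
  next
    assume "\<exists>d\<in>D. dec n = d \<otimes> dec m"
    then show "\<exists>d\<in>D. f (dec n) = d \<otimes> f (dec m)" using e dec_closed by metis
  qed
  then show "((code (f (dec m)), code (f (dec n))) \<in> E) = ((m, n) \<in> E)"
    unfolding E_def using neq fc by simp
qed

lemma lift_\<Theta>: "\<theta> \<in> \<Theta> \<Longrightarrow> lift \<theta> \<in> carrier X.Aut"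
  using \<Theta>(2) edge edge_back by (intro lift_closed) auto

definition S :: "((nat \<Rightarrow> nat) \<times> (nat \<Rightarrow> nat)) set" where
  "S = lift ` \<Theta> \<union> (\<lambda>\<theta>. inv\<^bsub>X.Aut\<^esub> (lift \<theta>)) ` \<Theta>"

lemma S_props:
  shows "finite S" "S \<subseteq> carrier X.Aut" "\<And>s. s \<in> S \<Longrightarrow> inv\<^bsub>X.Aut\<^esub> s \<in> S"
    "\<And>s. s \<in> S \<Longrightarrow> fst s (code \<one>) = code \<one>"
proof -
  show "finite S" unfolding S_def using \<Theta>(1) by simp
  show "S \<subseteq> carrier X.Aut" unfolding S_def using lift_\<Theta> by auto
  show "inv\<^bsub>X.Aut\<^esub> s \<in> S" if "s \<in> S" for s
    using that lift_\<Theta> unfolding S_def by auto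
  have fix1: "fst (lift \<theta>) (code \<one>) = code \<one>" if "\<theta> \<in> \<Theta>" for \<theta>
    using \<Theta>(3)[OF that] by (simp add: fst_lift)
  moreover have "fst (inv\<^bsub>X.Aut\<^esub> (lift \<theta>)) (code \<one>) = code \<one>" if "\<theta> \<in> \<Theta>" for \<theta>
    using X.Aut_inv(3)[OF lift_\<Theta>[OF that], of "code \<one>"] fix1[OF that] by simp
  ultimately show "fst s (code \<one>) = code \<one>" if "s \<in> S" for s
    using that unfolding S_def by blast
qed

text \<open>
  Distinct composites of maps in \<open>\<Theta>\<close> are induced by distinct elements of
  the generated group.
\<close>

lemma infinite_generate_S: "infinite (generate X.Aut S)"
proof
  assume fin: "finite (generate X.Aut S)"
  have "\<exists>k\<in>generate X.Aut S. \<forall>g\<in>carrier G. fst k (code g) = code (foldr (\<lambda>f. f) fs g) \<and>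
      foldr (\<lambda>f. f) fs g \<in> carrier G" if "fs \<in> lists \<Theta>" for fs
    using that
  proof (induction rule: lists.induct)
    case Nil
    show ?case by (rule bexI[OF _ generate.one]) (simp add: one_graph_Aut)
  next
    case (Cons \<theta> fs)
    note \<theta> = Cons.hyps(1)
    obtain k where k: "k \<in> generate X.Aut S"
      "\<forall>g\<in>carrier G. fst k (code g) = code (foldr (\<lambda>f. f) fs g) \<and> foldr (\<lambda>f. f) fs g \<in> carrier G"
      using Cons.IH by blast
    have "lift \<theta> \<in> generate X.Aut S" using \<theta> unfolding S_def by (intro generate.incl) blast
    then have "lift \<theta> \<otimes>\<^bsub>X.Aut\<^esub> k \<in> generate X.Aut S" using k(1) by (rule generate.eng)
    moreover have "fst (lift \<theta> \<otimes>\<^bsub>X.Aut\<^esub> k) (code g) = code (foldr (\<lambda>f. f) (\<theta> # fs) g)"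
      "foldr (\<lambda>f. f) (\<theta> # fs) g \<in> carrier G" if g: "g \<in> carrier G" for g
    proof -
      note kg = bspec[OF k(2) g, THEN conjunct1] bspec[OF k(2) g, THEN conjunct2]
      show "fst (lift \<theta> \<otimes>\<^bsub>X.Aut\<^esub> k) (code g) = code (foldr (\<lambda>f. f) (\<theta> # fs) g)"
        using kg by (simp add: fst_mult_graph_Aut fst_lift)
      show "foldr (\<lambda>f. f) (\<theta> # fs) g \<in> carrier G"
        using bij_betw_apply[OF \<Theta>(2)[OF \<theta>] kg(2)] by simp
    qed
    ultimately show ?case by blast
  qed
  then have ex: "\<exists>k\<in>generate X.Aut S. \<forall>g\<in>carrier G. dec (fst k (code g)) = foldr (\<lambda>f. f) fs g"
    if "fs \<in> lists \<Theta>" for fs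
    using that dec_code by metis
  have "(\<lambda>fs. restrict (foldr (\<lambda>f. f) fs) (carrier G)) ` lists \<Theta> \<subseteq>
    (\<lambda>k. \<lambda>g\<in>carrier G. dec (fst k (code g))) ` generate X.Aut S"
  proof
    fix f assume "f \<in> (\<lambda>fs. restrict (foldr (\<lambda>f. f) fs) (carrier G)) ` lists \<Theta>"
    then obtain fs where fs: "fs \<in> lists \<Theta>" "f = restrict (foldr (\<lambda>f. f) fs) (carrier G)" by blast
    obtain k where k: "k \<in> generate X.Aut S"
      "\<forall>g\<in>carrier G. dec (fst k (code g)) = foldr (\<lambda>f. f) fs g" using ex[OF fs(1)] by blast
    then have "f = (\<lambda>g\<in>carrier G. dec (fst k (code g)))" unfolding fs(2) by (intro restrict_ext) simp
    then show "f \<in> (\<lambda>k. \<lambda>g\<in>carrier G. dec (fst k (code g))) ` generate X.Aut S" using k(1) by blast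
  qed
  then show False using inf_\<Theta> fin by (meson finite_imageI finite_subset)
qed

text \<open>
  The inverse turns right multiplication into a left action.
\<close>

definition trans :: "'a \<Rightarrow> (nat \<Rightarrow> nat) \<times> (nat \<Rightarrow> nat)" where
  "trans k = lift (\<lambda>g. g \<otimes> inv k)"

lemma fst_trans: "fst (trans k) n = code (dec n \<otimes> inv k)"
  by (simp add: trans_def fst_lift)

lemma trans_closed:
  assumes k: "k \<in> carrier G"
  shows "trans k \<in> carrier X.Aut"
  unfolding trans_def
proof (rule lift_closed)
  show "bij_betw (\<lambda>g. g \<otimes> inv k) (carrier G) (carrier G)"
    by (rule bij_betw_byWitness[where f' = "\<lambda>g. g \<otimes> k"]) (use k in \<open>auto simp: m_assoc\<close>)
  fix d g assume dg: "d \<in> D" "g \<in> carrier G"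
  then have "d \<otimes> g \<otimes> inv k = d \<otimes> (g \<otimes> inv k)" using k D(2) by (auto simp: m_assoc)
  then show "\<exists>d'\<in>D. d \<otimes> g \<otimes> inv k = d' \<otimes> (g \<otimes> inv k)"
    "\<exists>d'\<in>D. d' \<otimes> g \<otimes> inv k = d \<otimes> (g \<otimes> inv k)" using dg(1) by blast+
qed

text \<open>
  For the lift \<open>t\<close> of a map in \<open>\<Theta>\<close> this is
  \<open>exch\<close>. For its inverse, \<open>exch_back\<close> provides another lift
  \<open>t'\<close> and translations \<open>u\<close>, \<open>u'\<close> with \<open>t' u = u'
  t\<close>, which rearranges to \<open>u t\<inverse> = t'\<inverse> u'\<close>.
\<close>

lemma exchange_trans:
  assumes k: "k \<in> carrier G" and s: "s \<in> S"
  shows "\<exists>s'\<in>S. \<exists>k'\<in>carrier G. \<forall>n. fst (trans k) (fst s n) = fst s' (fst (trans k') n)"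
proof -
  have \<Theta>c: "\<theta> g \<in> carrier G" if "\<theta> \<in> \<Theta>" "g \<in> carrier G" for \<theta> g
    using \<Theta>(2)[OF that(1)] that(2) by (rule bij_betw_apply)
  consider \<theta> where "\<theta> \<in> \<Theta>" "s = lift \<theta>" | \<theta> where "\<theta> \<in> \<Theta>" "s = inv\<^bsub>X.Aut\<^esub> (lift \<theta>)"
    using s unfolding S_def by blast
  then show ?thesis
  proof cases
    case 1
    obtain \<theta>' h where h: "\<theta>' \<in> \<Theta>" "h \<in> carrier G"
      "\<And>g. g \<in> carrier G \<Longrightarrow> \<theta>' (g \<otimes> h) = \<theta> g \<otimes> inv k"
      using exch[OF 1(1), of "inv k"] k by blast
    have "fst (trans k) (fst s n) = fst (lift \<theta>') (fst (trans (inv h)) n)" for n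
      unfolding 1(2) fst_trans fst_lift using h 1(1) \<Theta>c by simp
    moreover have "lift \<theta>' \<in> S" unfolding S_def using h(1) by blast
    ultimately show ?thesis using h(2) inv_closed by blast
  next
    case 2
    obtain \<theta>' h where h: "\<theta>' \<in> \<Theta>" "h \<in> carrier G"
      "\<And>g. g \<in> carrier G \<Longrightarrow> \<theta>' (g \<otimes> inv k) = \<theta> g \<otimes> h"
      using exch_back[OF 2(1), of "inv k"] k by blast
    let ?t = "lift \<theta>" and ?t' = "lift \<theta>'"
    have t: "?t \<in> carrier X.Aut" "?t' \<in> carrier X.Aut" using lift_\<Theta> 2(1) h(1) by auto
    have comm: "fst ?t' (fst (trans k) m) = fst (trans (inv h)) (fst ?t m)" for m
      unfolding fst_trans fst_lift using h 2(1) \<Theta>c k by simp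
    have "fst (trans k) (fst s n) = fst (inv\<^bsub>X.Aut\<^esub> ?t') (fst (trans (inv h)) n)" for n
    proof -
      have "fst (trans k) (fst s n) = fst (inv\<^bsub>X.Aut\<^esub> ?t') (fst ?t' (fst (trans k) (fst s n)))"
        using X.Aut_inv(3)[OF t(2)] by simp
      also have "\<dots> = fst (inv\<^bsub>X.Aut\<^esub> ?t') (fst (trans (inv h)) (fst ?t (fst s n)))"
        by (simp only: comm)
      also have "fst ?t (fst s n) = n" unfolding 2(2) using X.Aut_inv(1)[OF t(1)] .
      finally show ?thesis .
    qed
    moreover have "inv\<^bsub>X.Aut\<^esub> ?t' \<in> S" unfolding S_def using h(1) by blast
    ultimately show ?thesis using h(2) inv_closed by blast
  qed
qed

text \<open>
  Stated for every group isomorphic to the one carrying the maps, so that an abstract group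
  can be handled through a concrete model of it.
\<close>

theorem cayley_graph_witness:
  assumes H: "group H" and iso: "H \<cong> G"
  shows "\<exists>(X :: (nat, nat) pre_digraph) r \<phi>.
    bidirected_digraph X r \<and> Digraph_Component.connected X \<and> locally_finite X \<and>
    inj_on \<phi> (carrier H) \<and> geometric_action H X r \<phi> \<and>
    (\<exists>x\<in>verts X. \<exists>J.
       fin_gen_subgroup J (graph_Aut X r) \<and>
       J \<subseteq> commensurator (graph_Aut X r) (\<phi> ` carrier H) \<inter> stabilizer (graph_Aut X r) fst x \<and>
       \<not> discrete_subset (Aut_topology X r) J) \<and>
    \<not> compact_by_discrete (graph_Aut X r) (Aut_topology X r)"
proof -
  obtain \<psi> where \<psi>: "\<psi> \<in> iso H G" using iso unfolding is_iso_def by blast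
  have mult: "\<psi> (a \<otimes>\<^bsub>H\<^esub> b) = \<psi> a \<otimes> \<psi> b" if "a \<in> carrier H" "b \<in> carrier H" for a b
    using \<psi> that by (auto simp: iso_def hom_def)
  have bij: "bij_betw \<psi> (carrier H) (carrier G)" using \<psi> by (simp add: iso_def)
  have \<psi>c: "\<psi> a \<in> carrier G" if "a \<in> carrier H" for a using bij that by (rule bij_betw_apply)
  let ?\<phi> = "\<lambda>a. trans (\<psi> a)"
  have conn: "Digraph_Component.connected X" using connected_E by (rule connected_nat_graph)
  have lf: "locally_finite X" using finite_neighbours by (rule locally_finite_nat_graph)
  have hom: "?\<phi> \<in> hom H X.Aut"
  proof (rule homI)
    show "?\<phi> a \<in> carrier X.Aut" if "a \<in> carrier H" for a using \<psi>c[OF that] by (rule trans_closed)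
    fix a b assume ab: "a \<in> carrier H" "b \<in> carrier H"
    interpret H: group H by (rule H)
    show "?\<phi> (a \<otimes>\<^bsub>H\<^esub> b) = ?\<phi> a \<otimes>\<^bsub>X.Aut\<^esub> ?\<phi> b"
    proof (rule X.Aut_eqI[OF nomulti_nat_graph])
      show "?\<phi> (a \<otimes>\<^bsub>H\<^esub> b) \<in> carrier X.Aut" "?\<phi> a \<otimes>\<^bsub>X.Aut\<^esub> ?\<phi> b \<in> carrier X.Aut"
        using ab \<psi>c trans_closed by auto
      show "fst (?\<phi> (a \<otimes>\<^bsub>H\<^esub> b)) n = fst (?\<phi> a \<otimes>\<^bsub>X.Aut\<^esub> ?\<phi> b) n" for n
        using ab \<psi>c by (simp add: fst_mult_graph_Aut fst_trans mult inv_mult_group m_assoc)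
    qed
  qed
  have "bij_betw (\<lambda>g. code (inv g)) (carrier G) UNIV"
    by (rule bij_betw_byWitness[where f' = "\<lambda>n. inv (dec n)"]) auto
  then have "bij_betw ((\<lambda>g. code (inv g)) \<circ> \<psi>) (carrier H) UNIV"
    using bij by (meson bij_betw_trans)
  moreover have "fst (?\<phi> a) (code \<one>) = ((\<lambda>g. code (inv g)) \<circ> \<psi>) a" if "a \<in> carrier H" for a
    using \<psi>c[OF that] by (simp add: fst_trans)
  then have "bij_betw (\<lambda>a. fst (?\<phi> a) (code \<one>)) (carrier H) UNIV =
      bij_betw ((\<lambda>g. code (inv g)) \<circ> \<psi>) (carrier H) UNIV" by (rule bij_betw_cong)
  ultimately have st: "bij_betw (\<lambda>a. fst (?\<phi> a) (code \<one>)) (carrier H) (verts X)"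
    by (simp add: nat_graph_def)
  have x: "code \<one> \<in> verts X" by (simp add: nat_graph_def)
  have ex: "\<exists>s'\<in>S. \<exists>h'\<in>carrier H. \<forall>v\<in>verts X. fst (?\<phi> h) (fst s v) = fst s' (fst (?\<phi> h') v)"
    if h: "h \<in> carrier H" and s: "s \<in> S" for h s
  proof -
    obtain s' k' where s': "s' \<in> S" "k' \<in> carrier G"
      "\<And>n. fst (?\<phi> h) (fst s n) = fst s' (fst (trans k') n)"
      using exchange_trans[OF \<psi>c[OF h] s] by blast
    obtain h' where "h' \<in> carrier H" "k' = \<psi> h'"
      using bij s'(2) unfolding bij_betw_def by blast
    then show ?thesis using s' by blast
  qed
  show ?thesis
    by (intro exI[of _ X] exI[of _ r] exI[of _ ?\<phi>] conjI X.bidirected_digraph conn lf;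
        insert X.commensurated_action[OF nomulti_nat_graph lf conn x H hom st S_props ex infinite_generate_S];
        blast)
qed

end

section \<open>Sections of the elements of a bireversible group\<close>

locale bireversible =
  fixes M :: "('a, 'q) mealy"
  assumes bireversible: "bireversible_automaton M"
begin

abbreviation "A \<equiv> alphabet M"
abbreviation "Q \<equiv> states M"
abbreviation "L \<equiv> lists A"
abbreviation "B \<equiv> BijGroup L"

sublocale B: group B by (rule group_BijGroup)

lemma finite_A: "finite A" and finite_Q: "finite Q"
  using bireversible by (auto simp: bireversible_automaton_def mealy_automaton_def)

lemma out_closed: "q \<in> Q \<Longrightarrow> a \<in> A \<Longrightarrow> out M q a \<in> A"
  and nxt_closed: "q \<in> Q \<Longrightarrow> a \<in> A \<Longrightarrow> nxt M q a \<in> Q"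
  using bireversible by (auto simp: bireversible_automaton_def mealy_automaton_def)

lemma out_bij: "q \<in> Q \<Longrightarrow> bij_betw (out M q) A A"
  using bireversible by (auto simp: bireversible_automaton_def invertible_automaton_def)

lemma nxt_surj:
  assumes "q \<in> Q" "a \<in> A"
  obtains q' where "q' \<in> Q" "nxt M q' a = q"
proof -
  have "(\<lambda>q. nxt M q a) ` Q = Q"
    using bireversible assms(2)
    by (simp add: bireversible_automaton_def reversible_automaton_def bij_betw_def)
  then have "q \<in> (\<lambda>q. nxt M q a) ` Q" using assms(1) by simp
  then show thesis using that by blast
qed

lemma transition_surj:
  assumes "q \<in> Q" "a \<in> A"
  obtains q' b where "q' \<in> Q" "b \<in> A" "out M q' b = a" "nxt M q' b = q"
proof -
  have "(\<lambda>(q, a). (out M q a, nxt M q a)) ` (Q \<times> A) = A \<times> Q"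
    using bireversible by (simp add: bireversible_automaton_def bij_betw_def)
  then have "(a, q) \<in> (\<lambda>(q, a). (out M q a, nxt M q a)) ` (Q \<times> A)" using assms by simp
  then show thesis using that by auto
qed

lemma out_word_closed: "q \<in> Q \<Longrightarrow> w \<in> L \<Longrightarrow> out_word M q w \<in> L"
  by (induction w arbitrary: q) (auto simp: out_closed nxt_closed)

text \<open>
  The first letter of the image determines the first letter of the word, by invertibility, and
  then the state that processes the remainder.
\<close>

lemma out_word_bij:
  assumes "q \<in> Q"
  shows "bij_betw (out_word M q) L L"
proof (rule bij_betw_imageI)
  have "w = w'" if "q \<in> Q" "w \<in> L" "w' \<in> L" "out_word M q w = out_word M q w'" for q w w'
    using that
  proof (induction w arbitrary: q w')
    case Nil
    then show ?case by (cases w') auto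
  next
    case (Cons a w)
    then obtain b v where w': "w' = b # v" by (cases w') auto
    have "a = b"
      using out_bij[OF Cons(2)] Cons w' by (auto simp: bij_betw_def inj_on_def)
    then show ?case using Cons w' nxt_closed by auto
  qed
  then show "inj_on (out_word M q) L" using assms unfolding inj_on_def by blast
  have "\<exists>w\<in>L. out_word M q w = v" if "q \<in> Q" "v \<in> L" for q v
    using that
  proof (induction v arbitrary: q)
    case Nil
    then show ?case by (intro bexI[of _ "[]"]) auto
  next
    case (Cons b v)
    have "b \<in> out M q ` A" using out_bij[OF Cons(2)] Cons(3) by (simp add: bij_betw_def)
    then obtain a where a: "a \<in> A" "out M q a = b" by blast
    have "v \<in> L" using Cons(3) by simp
    then obtain w where "w \<in> L" "out_word M (nxt M q a) w = v"
      using Cons.IH[OF nxt_closed[OF Cons(2) a(1)]] by blast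
    with a show ?case by (intro bexI[of _ "a # w"]) auto
  qed
  then show "out_word M q ` L = L" using assms out_word_closed by blast
qed

lemma state_perm_Bij: "q \<in> Q \<Longrightarrow> state_perm M q \<in> carrier B"
  using out_word_bij unfolding BijGroup_def Bij_def state_perm_def
  by (simp add: bij_betw_cong[of L "restrict _ L"])

lemma B_apply: "f \<in> carrier B \<Longrightarrow> g \<in> carrier B \<Longrightarrow> w \<in> L \<Longrightarrow> (f \<otimes>\<^bsub>B\<^esub> g) w = f (g w)"
  by (simp add: BijGroup_def compose_eq)

lemma B_one_apply: "w \<in> L \<Longrightarrow> \<one>\<^bsub>B\<^esub> w = w"
  by (simp add: BijGroup_def)

lemma B_closed: "f \<in> carrier B \<Longrightarrow> w \<in> L \<Longrightarrow> f w \<in> L"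
  by (auto simp: BijGroup_def dest: Bij_imp_funcset)

lemma B_inv_apply: "f \<in> carrier B \<Longrightarrow> w \<in> L \<Longrightarrow> (inv\<^bsub>B\<^esub> f) (f w) = w"
  using B_apply[of "inv\<^bsub>B\<^esub> f" f w] by (simp add: B_one_apply)

lemma B_eqI:
  assumes "f \<in> carrier B" "g \<in> carrier B" "\<And>w. w \<in> L \<Longrightarrow> f w = g w"
  shows "f = g"
  using assms by (intro extensionalityI[of f L g]) (auto simp: BijGroup_def Bij_def)

definition letter :: "'q \<times> bool \<Rightarrow> 'a list \<Rightarrow> 'a list" where
  "letter x = (if snd x then state_perm M (fst x) else inv\<^bsub>B\<^esub> (state_perm M (fst x)))"

lemma word_perm_Nil: "word_perm M [] = \<one>\<^bsub>B\<^esub>"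
  and word_perm_Cons: "word_perm M (x # w) = letter x \<otimes>\<^bsub>B\<^esub> word_perm M w"
  by (simp_all add: word_perm_def letter_def Let_def split: prod.split)

lemma letter_closed: "fst x \<in> Q \<Longrightarrow> letter x \<in> carrier B"
  by (simp add: letter_def state_perm_Bij)

lemma letter_flip: "fst x \<in> Q \<Longrightarrow> letter (flip x) = inv\<^bsub>B\<^esub> (letter x)"
  by (simp add: letter_def flip_def state_perm_Bij)

lemma word_perm_closed: "fst ` set w \<subseteq> Q \<Longrightarrow> word_perm M w \<in> carrier B"
  by (induction w) (auto simp: word_perm_Nil word_perm_Cons letter_closed)

text \<open>
  Cancelling a letter against its inverse does not change the permutation, so the homomorphism
  may be computed on unreduced words.
\<close>

lemma word_perm_free_cons:
  assumes "fst x \<in> Q" "fst ` set w \<subseteq> Q"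
  shows "word_perm M (free_cons x w) = letter x \<otimes>\<^bsub>B\<^esub> word_perm M w"
proof (cases w)
  case Nil
  then show ?thesis by (simp add: free_cons_def word_perm_Cons)
next
  case (Cons y v)
  show ?thesis
  proof (cases "y = flip x")
    case True
    have "letter x \<otimes>\<^bsub>B\<^esub> (inv\<^bsub>B\<^esub> letter x \<otimes>\<^bsub>B\<^esub> word_perm M v) = word_perm M v"
      using assms Cons letter_closed[of x] word_perm_closed[of v]
      by (simp add: B.m_assoc[symmetric])
    then show ?thesis
      using True Cons assms by (simp add: free_cons_def word_perm_Cons letter_flip)
  qed (use Cons in \<open>simp add: free_cons_def word_perm_Cons\<close>)
qed

lemma word_perm_mult:
  assumes "fst ` set u \<subseteq> Q" "v \<in> carrier (free_group Q)"
  shows "word_perm M (foldr free_cons u v) = word_perm M u \<otimes>\<^bsub>B\<^esub> word_perm M v"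
  using assms(1)
proof (induction u)
  case Nil
  then show ?case using assms(2) by (simp add: word_perm_Nil word_perm_closed free_group_def)
next
  case (Cons x u)
  have "foldr free_cons u v \<in> carrier (free_group Q)"
    using Cons.prems assms(2) by (intro free_mult_closed) auto
  then have "fst ` set (foldr free_cons u v) \<subseteq> Q" by (simp add: free_group_def)
  then show ?case
    using Cons assms(2)
    by (simp add: word_perm_free_cons word_perm_Cons letter_closed word_perm_closed B.m_assoc free_group_def)
qed

text \<open>
  All words are allowed, not only reduced ones: this makes inductions over words available.
\<close>

definition P :: "('a list \<Rightarrow> 'a list) set" where
  "P = word_perm M ` {w. fst ` set w \<subseteq> Q}"

lemma P_free_group: "P = word_perm M ` carrier (free_group Q)"
proof
  show "P \<subseteq> word_perm M ` carrier (free_group Q)"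
  proof
    fix p assume "p \<in> P"
    then obtain w where w: "fst ` set w \<subseteq> Q" "p = word_perm M w" unfolding P_def by blast
    have one: "[] \<in> carrier (free_group Q)" by (simp add: free_group_def reduced_word_def)
    have "p = word_perm M (foldr free_cons w [])"
      using w word_perm_mult[OF w(1) one] word_perm_closed[OF w(1)] by (simp add: word_perm_Nil)
    then show "p \<in> word_perm M ` carrier (free_group Q)"
      using free_mult_closed[OF w(1) one] by blast
  qed
qed (auto simp: P_def free_group_def)

lemma word_perm_hom: "group_hom (free_group Q) B (word_perm M)"
proof -
  interpret F: group "free_group Q" by (rule group_free_group)
  show ?thesis
    by unfold_locales (auto simp: hom_def word_perm_closed word_perm_mult free_group_def)
qed

lemma subgroup_P: "subgroup P B"
  unfolding P_free_group by (rule group_hom.img_is_subgroup[OF word_perm_hom])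

lemma mealy_group_iso: "mealy_group M \<cong> B\<lparr>carrier := P\<rparr>"
proof -
  interpret W: group_hom "free_group Q" B "word_perm M" by (rule word_perm_hom)
  interpret S: group "B\<lparr>carrier := P\<rparr>" by (rule B.subgroup_imp_group[OF subgroup_P])
  have hom: "group_hom (free_group Q) (B\<lparr>carrier := P\<rparr>) (word_perm M)"
    by unfold_locales (auto simp: hom_def P_free_group)
  have "kernel (free_group Q) (B\<lparr>carrier := P\<rparr>) (word_perm M) = kernel (free_group Q) B (word_perm M)"
    by (simp add: kernel_def)
  then show ?thesis
    using group_hom.FactGroup_iso[OF hom] by (simp add: mealy_group_def P_free_group)
qed

lemma P_closed: "p \<in> P \<Longrightarrow> p \<in> carrier B"
  using subgroup_P by (rule subgroup.mem_carrier)

lemma P_mult: "p \<in> P \<Longrightarrow> q \<in> P \<Longrightarrow> p \<otimes>\<^bsub>B\<^esub> q \<in> P"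
  using subgroup_P by (rule subgroup.m_closed)

lemma P_inv: "p \<in> P \<Longrightarrow> inv\<^bsub>B\<^esub> p \<in> P"
  using subgroup_P by (rule subgroup.m_inv_closed)

lemma P_letter:
  assumes "fst x \<in> Q"
  shows "letter x \<in> P"
proof -
  have "word_perm M [x] \<in> P" unfolding P_def using assms by auto
  then show ?thesis using assms by (simp add: word_perm_Cons word_perm_Nil letter_closed)
qed

text \<open>
  An element \<open>p\<close> maps the word \<open>a w\<close> to \<open>root_letter p
  a\<close> followed by \<open>sec a p\<close> applied to \<open>w\<close>.
\<close>

definition root_letter :: "('a list \<Rightarrow> 'a list) \<Rightarrow> 'a \<Rightarrow> 'a" where
  "root_letter p a = hd (p [a])"

definition sec :: "'a \<Rightarrow> ('a list \<Rightarrow> 'a list) \<Rightarrow> 'a list \<Rightarrow> 'a list" where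
  "sec a p = (\<lambda>w\<in>L. tl (p (a # w)))"

lemma section_unique:
  assumes "p' \<in> carrier B" "\<And>w. w \<in> L \<Longrightarrow> p (a # w) = b # p' w"
  shows "sec a p = p'" "root_letter p a = b"
proof -
  show "root_letter p a = b" using assms(2)[of "[]"] by (simp add: root_letter_def)
  have "p' \<in> extensional L" using assms(1) by (simp add: BijGroup_def Bij_def)
  then show "sec a p = p'" unfolding sec_def using assms(2) by (auto simp: extensional_def)
qed

lemma state_perm_step: "q \<in> Q \<Longrightarrow> a \<in> A \<Longrightarrow> w \<in> L \<Longrightarrow>
    letter (q, True) (a # w) = out M q a # letter (nxt M q a, True) w"
  by (simp add: letter_def state_perm_def)

lemma inverse_step:
  assumes "q \<in> Q" "a \<in> A" "w \<in> L"
  shows "letter (q, False) (out M q a # w) = a # letter (nxt M q a, False) w"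
proof -
  have n: "nxt M q a \<in> Q" using assms by (simp add: nxt_closed)
  let ?v = "letter (nxt M q a, False) w"
  have v: "?v \<in> L" using n assms(3) by (simp add: B_closed letter_closed)
  have "letter (nxt M q a, True) ?v = (letter (nxt M q a, True) \<otimes>\<^bsub>B\<^esub> letter (nxt M q a, False)) w"
    using n assms by (simp add: B_apply letter_closed)
  also have "\<dots> = w" using n assms by (simp add: letter_def state_perm_Bij B_one_apply)
  finally have "letter (q, True) (a # ?v) = out M q a # w"
    using state_perm_step[OF assms(1,2) v] by simp
  then have "letter (q, False) (out M q a # w) = letter (q, False) (letter (q, True) (a # ?v))"
    by simp
  also have "\<dots> = a # ?v"
    using assms v by (simp add: letter_def B_inv_apply state_perm_Bij)
  finally show ?thesis .
qed

lemma letter_step: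
  assumes x: "fst x \<in> Q" and a: "a \<in> A"
  obtains b y where "b \<in> A" "fst y \<in> Q" "\<And>w. w \<in> L \<Longrightarrow> letter x (a # w) = b # letter y w"
proof (cases "snd x")
  case True
  then have "x = (fst x, True)" by (simp add: prod_eq_iff)
  then show ?thesis
    using that[of "out M (fst x) a" "(nxt M (fst x) a, True)"] state_perm_step[OF x a]
      out_closed[OF x a] nxt_closed[OF x a] by simp
next
  case False
  then have xe: "x = (fst x, False)" by (simp add: prod_eq_iff)
  have "a \<in> out M (fst x) ` A" using out_bij[OF x] a by (simp add: bij_betw_def)
  then obtain b where b: "b \<in> A" "out M (fst x) b = a" by blast
  show ?thesis
    using that[of b "(nxt M (fst x) b, False)"] inverse_step[OF x b(1)] b xe
      nxt_closed[OF x b(1)] by simp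
qed

text \<open>
  Sections of a product of \<open>n\<close> letters are products of \<open>n\<close> letters:
  the letters are processed from the right, each passing its output on to the next.
\<close>

lemma word_step:
  assumes "fst ` set w \<subseteq> Q" "a \<in> A"
  shows "\<exists>b\<in>A. \<exists>w'. fst ` set w' \<subseteq> Q \<and> length w' = length w \<and>
    (\<forall>u\<in>L. word_perm M w (a # u) = b # word_perm M w' u)"
  using assms(1)
proof (induction w)
  case Nil
  then show ?case using assms(2) by (intro bexI[of _ a] exI[of _ "[]"]) (auto simp: word_perm_Nil B_one_apply)
next
  case (Cons x w)
  then obtain b w' where w': "b \<in> A" "fst ` set w' \<subseteq> Q" "length w' = length w"
    "\<And>u. u \<in> L \<Longrightarrow> word_perm M w (a # u) = b # word_perm M w' u" by auto
  have x: "fst x \<in> Q" using Cons by simp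
  obtain c y where y: "c \<in> A" "fst y \<in> Q" "\<And>u. u \<in> L \<Longrightarrow> letter x (b # u) = c # letter y u"
    using letter_step[OF x w'(1)] by blast
  have "word_perm M (x # w) (a # u) = c # word_perm M (y # w') u" if u: "u \<in> L" for u
  proof -
    have "word_perm M w' u \<in> L" using word_perm_closed[OF w'(2)] u by (rule B_closed)
    then show ?thesis
      using Cons.prems x u assms(2) w' y
      by (simp add: word_perm_Cons B_apply letter_closed word_perm_closed)
  qed
  moreover have "fst ` set (y # w') \<subseteq> Q" "length (y # w') = length (x # w)"
    using y(2) w'(2,3) by auto
  ultimately show ?case using y(1) by blast
qed

lemma section_word:
  assumes "fst ` set w \<subseteq> Q" "a \<in> A"
  obtains w' where "fst ` set w' \<subseteq> Q" "length w' = length w" "sec a (word_perm M w) = word_perm M w'"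
    "root_letter (word_perm M w) a \<in> A"
    "\<And>u. u \<in> L \<Longrightarrow> word_perm M w (a # u) = root_letter (word_perm M w) a # sec a (word_perm M w) u"
proof -
  obtain b w' where w': "b \<in> A" "fst ` set w' \<subseteq> Q" "length w' = length w"
    "\<And>u. u \<in> L \<Longrightarrow> word_perm M w (a # u) = b # word_perm M w' u"
    using word_step[OF assms] by auto
  note u = section_unique[OF word_perm_closed[OF w'(2)] w'(4)]
  show thesis using that[of w'] w' u by simp
qed

lemma
  assumes p: "p \<in> P" and a: "a \<in> A"
  shows sec_closed: "sec a p \<in> P" and root_letter_closed: "root_letter p a \<in> A"
    and step: "u \<in> L \<Longrightarrow> p (a # u) = root_letter p a # sec a p u"
proof -
  obtain w where w: "fst ` set w \<subseteq> Q" "p = word_perm M w" using p unfolding P_def by blast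
  show "sec a p \<in> P" "root_letter p a \<in> A" "u \<in> L \<Longrightarrow> p (a # u) = root_letter p a # sec a p u"
    using section_word[OF w(1) a] w(2) unfolding P_def by (metis (mono_tags) image_eqI mem_Collect_eq)+
qed

lemma
  assumes p: "p \<in> P" and q: "q \<in> P" and a: "a \<in> A"
  shows sec_mult: "sec a (p \<otimes>\<^bsub>B\<^esub> q) = sec (root_letter q a) p \<otimes>\<^bsub>B\<^esub> sec a q"
    and root_letter_mult: "root_letter (p \<otimes>\<^bsub>B\<^esub> q) a = root_letter p (root_letter q a)"
proof -
  have b: "root_letter q a \<in> A" using q a by (rule root_letter_closed)
  have c: "sec (root_letter q a) p \<otimes>\<^bsub>B\<^esub> sec a q \<in> carrier B"
    using p q a b by (intro P_closed P_mult sec_closed)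
  have "(p \<otimes>\<^bsub>B\<^esub> q) (a # w) = root_letter p (root_letter q a) # (sec (root_letter q a) p \<otimes>\<^bsub>B\<^esub> sec a q) w" if w: "w \<in> L" for w
  proof -
    have "sec a q w \<in> L" using P_closed[OF sec_closed[OF q a]] w by (rule B_closed)
    then show ?thesis
      using p q a b w by (simp add: B_apply P_closed sec_closed step)
  qed
  from section_unique[OF c this]
  show "sec a (p \<otimes>\<^bsub>B\<^esub> q) = sec (root_letter q a) p \<otimes>\<^bsub>B\<^esub> sec a q" "root_letter (p \<otimes>\<^bsub>B\<^esub> q) a = root_letter p (root_letter q a)"
    by auto
qed

lemma
  assumes "a \<in> A"
  shows sec_one: "sec a \<one>\<^bsub>B\<^esub> = \<one>\<^bsub>B\<^esub>" and root_letter_one: "root_letter \<one>\<^bsub>B\<^esub> a = a"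
proof -
  have "\<one>\<^bsub>B\<^esub> (a # w) = a # \<one>\<^bsub>B\<^esub> w" if "w \<in> L" for w
    using that assms by (simp add: B_one_apply)
  from section_unique[OF B.one_closed this]
  show "sec a \<one>\<^bsub>B\<^esub> = \<one>\<^bsub>B\<^esub>" "root_letter \<one>\<^bsub>B\<^esub> a = a" by simp_all
qed

definition D :: "('a list \<Rightarrow> 'a list) set" where
  "D = letter ` {x. fst x \<in> Q}"

lemma D_E:
  assumes "d \<in> D"
  obtains x where "fst x \<in> Q" "d = letter x"
proof -
  from assms obtain x where x: "x \<in> {x. fst x \<in> Q}" "d = letter x"
    unfolding D_def by (rule imageE)
  from x(1) have "fst x \<in> Q" by (rule CollectD)
  then show thesis using x(2) by (rule that)
qed

lemma D_I: "fst x \<in> Q \<Longrightarrow> letter x \<in> D"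
  unfolding D_def by (intro imageI CollectI)

lemma sec_D:
  assumes "d \<in> D" "a \<in> A"
  shows "sec a d \<in> D"
proof -
  obtain x where x: "fst x \<in> Q" "d = letter x" using assms(1) by (rule D_E)
  obtain b y where y: "fst y \<in> Q" "\<And>w. w \<in> L \<Longrightarrow> letter x (a # w) = b # letter y w"
    using letter_step[OF x(1) assms(2)] by metis
  have "sec a d = letter y" using section_unique(1)[OF letter_closed[OF y(1)] y(2)] x by simp
  then show ?thesis using y unfolding D_def by blast
qed

text \<open>
  For a state this is reversibility. For the inverse of a state one needs a transition with
  prescribed output letter and prescribed target state, which is what bireversibility
  provides.
\<close>

lemma letter_sec_surj:
  assumes y: "fst y \<in> Q" and a: "a \<in> A"
  obtains x where "fst x \<in> Q" "sec a (letter x) = letter y"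
proof (cases "snd y")
  case True
  then have ye: "y = (fst y, True)" by (simp add: prod_eq_iff)
  obtain q where q: "q \<in> Q" "nxt M q a = fst y" using nxt_surj[OF y a] by blast
  have "sec a (letter (q, True)) = letter y"
    using state_perm_step[OF q(1) a] q ye y by (intro section_unique(1)[where b = "out M q a"] letter_closed) auto
  then show ?thesis using that[of "(q, True)"] q by simp
next
  case False
  then have ye: "y = (fst y, False)" by (simp add: prod_eq_iff)
  obtain q b where q: "q \<in> Q" "b \<in> A" "out M q b = a" "nxt M q b = fst y"
    using transition_surj[OF y a] by blast
  have "sec a (letter (q, False)) = letter y"
    using inverse_step[OF q(1,2)] q ye y by (intro section_unique(1)[where b = b] letter_closed) auto
  then show ?thesis using that[of "(q, False)"] q by simp
qed

lemma sec_D_surj: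
  assumes "d \<in> D" "a \<in> A"
  obtains d' where "d' \<in> D" "sec a d' = d"
proof -
  obtain y where y: "fst y \<in> Q" "d = letter y" using assms(1) by (rule D_E)
  obtain x where "fst x \<in> Q" "sec a (letter x) = letter y"
    using y(1) assms(2) by (rule letter_sec_surj)
  then show thesis using that[OF D_I] y(2) by simp
qed

text \<open>
  A preimage is built letter by letter from the right, since the letter at which the next
  section is taken is known only after the later letters have been chosen.
\<close>

lemma word_sec_surj:
  assumes "fst ` set w \<subseteq> Q" "a \<in> A"
  shows "\<exists>w'. fst ` set w' \<subseteq> Q \<and> length w' = length w \<and> sec a (word_perm M w') = word_perm M w"
  using assms(1)
proof (induction w)
  case Nil
  have "sec a (word_perm M []) = word_perm M []"
    unfolding word_perm_Nil using assms(2) by (rule sec_one)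
  then show ?case by (intro exI[of _ "[]"]) simp
next
  case (Cons y w)
  have y: "fst y \<in> Q" and w: "fst ` set w \<subseteq> Q" using Cons.prems by auto
  obtain w' where w': "fst ` set w' \<subseteq> Q" "length w' = length w"
    "sec a (word_perm M w') = word_perm M w" using Cons.IH[OF w] by blast
  have p: "word_perm M w' \<in> P" using w'(1) unfolding P_def by blast
  obtain x where x: "fst x \<in> Q" "sec (root_letter (word_perm M w') a) (letter x) = letter y"
    using y root_letter_closed[OF p assms(2)] by (rule letter_sec_surj)
  have "sec a (word_perm M (x # w')) = word_perm M (y # w)"
    by (simp add: word_perm_Cons sec_mult[OF P_letter[OF x(1)] p assms(2)] x(2) w'(3))
  moreover have "fst ` set (x # w') \<subseteq> Q" "length (x # w') = length (y # w)"
    using x(1) w'(1,2) by auto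
  ultimately show ?case by blast
qed

text \<open>
  By \<open>word_sec_surj\<close> the section map sends each ball onto a set containing that
  ball. Balls are finite, so it is injective on each of them, and any two elements lie in a
  common ball.
\<close>

lemma sec_bij:
  assumes a: "a \<in> A"
  shows "bij_betw (sec a) P P"
proof (rule bij_betw_imageI)
  define W :: "nat \<Rightarrow> ('q \<times> bool) list set" where "W n = {w. fst ` set w \<subseteq> Q \<and> length w \<le> n}" for n
  have "finite (W n)" for n
  proof -
    have "W n = {w. set w \<subseteq> Q \<times> UNIV \<and> length w \<le> n}" unfolding W_def by force
    then show ?thesis using finite_lists_length_le[of "Q \<times> (UNIV :: bool set)" n] finite_Q by simp
  qed
  moreover have "word_perm M ` W n \<subseteq> sec a ` word_perm M ` W n" for n
  proof
    fix p assume "p \<in> word_perm M ` W n"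
    then obtain w where w: "fst ` set w \<subseteq> Q" "length w \<le> n" "p = word_perm M w"
      unfolding W_def by blast
    obtain w' where w': "fst ` set w' \<subseteq> Q" "length w' = length w" "sec a (word_perm M w') = word_perm M w"
      using word_sec_surj[OF w(1) a] by blast
    then have "w' \<in> W n" using w(2) unfolding W_def by simp
    then show "p \<in> sec a ` word_perm M ` W n" unfolding w(3) w'(3)[symmetric] by (intro imageI)
  qed
  ultimately have inj: "inj_on (sec a) (word_perm M ` W n)" for n
    by (intro finite_surj_inj) auto
  show "inj_on (sec a) P"
  proof (rule inj_onI)
    fix p p' assume p: "p \<in> P" "p' \<in> P" "sec a p = sec a p'"
    obtain w w' where w: "fst ` set w \<subseteq> Q" "p = word_perm M w" "fst ` set w' \<subseteq> Q" "p' = word_perm M w'"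
      using p unfolding P_def by blast
    then have "p \<in> word_perm M ` W (max (length w) (length w'))"
      "p' \<in> word_perm M ` W (max (length w) (length w'))"
      unfolding W_def by auto
    then show "p = p'" using inj p(3) unfolding inj_on_def by blast
  qed
  show "sec a ` P = P"
  proof
    show "sec a ` P \<subseteq> P" using sec_closed a by blast
    show "P \<subseteq> sec a ` P"
    proof
      fix p assume "p \<in> P"
      then obtain w where w: "fst ` set w \<subseteq> Q" "p = word_perm M w" unfolding P_def by blast
      obtain w' where w': "fst ` set w' \<subseteq> Q" "sec a (word_perm M w') = word_perm M w"
        using word_sec_surj[OF w(1) a] by blast
      have "word_perm M w' \<in> P" unfolding P_def using w'(1) by blast
      then show "p \<in> sec a ` P" unfolding w(2) w'(2)[symmetric] by (rule imageI)
    qed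
  qed
qed

lemma countable_P:
  assumes "countable Q"
  shows "countable P"
proof -
  have "{w. fst ` set w \<subseteq> Q} = lists (Q \<times> (UNIV :: bool set))" by (auto simp: lists_eq_set)
  then show ?thesis unfolding P_def using assms by (simp add: countable_lists)
qed

lemma generate_D: "generate (B\<lparr>carrier := P\<rparr>) D = P"
proof -
  have DP: "D \<subseteq> P" unfolding D_def using P_letter by blast
  have "word_perm M w \<in> generate B D" if "fst ` set w \<subseteq> Q" for w
    using that
  proof (induction w)
    case Nil
    then show ?case by (simp add: word_perm_Nil generate.one)
  next
    case (Cons x w)
    then have "letter x \<in> generate B D" unfolding D_def by (intro generate.incl) auto
    then show ?case using Cons by (simp add: word_perm_Cons generate.eng)
  qed
  then have "P \<subseteq> generate B D" unfolding P_def by blast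
  moreover have "generate B D \<subseteq> P" using B.generate_subgroup_incl[OF DP subgroup_P] .
  ultimately show ?thesis using B.generate_consistent[OF DP subgroup_P] by simp
qed

text \<open>
  An element \<open>p\<close> is determined by the function that assigns to each composite of
  section maps the action on letters of its value at \<open>p\<close>: the image of a word
  under \<open>p\<close> is computed one letter at a time, and each letter only involves an
  iterated section of \<open>p\<close>. If there are finitely many composites, there are
  finitely many such functions.
\<close>

lemma finite_sections_imp_finite:
  assumes "finite ((\<lambda>fs. restrict (foldr (\<lambda>f. f) fs) P) ` lists (sec ` A))" (is "finite ?F")
  shows "finite P"
proof -
  define \<Psi> where "\<Psi> p = (\<lambda>f\<in>?F. \<lambda>a\<in>A. root_letter (f p) a)" for p
  have fP: "foldr (\<lambda>f. f) fs p \<in> P" if "fs \<in> lists (sec ` A)" "p \<in> P" for fs p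
    using that(1) by (induction fs) (auto simp: that(2) sec_closed)
  have fF: "f p \<in> P" if "f \<in> ?F" "p \<in> P" for f p
  proof -
    from that(1) obtain fs where "f = restrict (foldr (\<lambda>f. f) fs) P" "fs \<in> lists (sec ` A)"
      by (rule imageE)
    then show ?thesis using fP that(2) by simp
  qed
  have "\<Psi> ` P \<subseteq> PiE ?F (\<lambda>_. PiE A (\<lambda>_. A))"
  proof (rule image_subsetI)
    fix p assume p: "p \<in> P"
    have "root_letter (f p) a \<in> A" if "f \<in> ?F" "a \<in> A" for f a
      using fF[OF that(1) p] that(2) by (rule root_letter_closed)
    then show "\<Psi> p \<in> PiE ?F (\<lambda>_. PiE A (\<lambda>_. A))"
      unfolding \<Psi>_def restrict_PiE_iff by blast
  qed
  then have "finite (\<Psi> ` P)"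
    using assms finite_A by (meson finite_PiE finite_subset)
  moreover have "inj_on \<Psi> P"
  proof (rule inj_onI)
    fix p p' assume p: "p \<in> P" "p' \<in> P" and eq: "\<Psi> p = \<Psi> p'"
    have same: "root_letter (foldr (\<lambda>f. f) fs p) a = root_letter (foldr (\<lambda>f. f) fs p') a"
      if fs: "fs \<in> lists (sec ` A)" and a: "a \<in> A" for fs a
    proof -
      have "restrict (foldr (\<lambda>f. f) fs) P \<in> ?F" using fs by (rule imageI)
      then show ?thesis
        using fun_cong[OF fun_cong[OF eq, of "restrict (foldr (\<lambda>f. f) fs) P"], of a] a p
        unfolding \<Psi>_def by simp
    qed
    have "foldr (\<lambda>f. f) fs p w = foldr (\<lambda>f. f) fs p' w" if "w \<in> L" "fs \<in> lists (sec ` A)" for fs w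
      using that
    proof (induction arbitrary: fs rule: lists.induct)
      case Nil
      have qnil: "q [] = []" if "q \<in> P" for q
      proof -
        obtain w where w: "fst ` set w \<subseteq> Q" "q = word_perm M w" using \<open>q \<in> P\<close> unfolding P_def by blast
        have nil: "letter x [] = []" if "fst x \<in> Q" for x
        proof -
          have *: "state_perm M (fst x) [] = []" by (simp add: state_perm_def)
          show ?thesis
            using * B_inv_apply[OF state_perm_Bij[OF that], of "[]"] by (simp add: letter_def)
        qed
        from w(1) have "word_perm M w [] = []"
          by (induction w) (simp_all add: word_perm_Nil B_one_apply word_perm_Cons B_apply letter_closed word_perm_closed nil)
        then show ?thesis using w(2) by simp
      qed
      show ?case
        unfolding qnil[OF fP[OF Nil(1) p(1)]] qnil[OF fP[OF Nil(1) p(2)]] by (rule HOL.refl)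
    next
      case (Cons a w)
      note a = Cons.hyps(1) and w = Cons.hyps(2)
      have "sec a # fs \<in> lists (sec ` A)" using a Cons.prems by auto
      then have "sec a (foldr (\<lambda>f. f) fs p) w = sec a (foldr (\<lambda>f. f) fs p') w"
        using Cons.IH[of "sec a # fs"] by simp
      then show ?case
        using step[OF fP[OF Cons.prems p(1)] a w] step[OF fP[OF Cons.prems p(2)] a w]
          same[OF Cons.prems a] by simp
    qed
    from this[of _ "[]"] show "p = p'"
      using p by (intro B_eqI P_closed) auto
  qed
  ultimately show ?thesis using finite_imageD by blast
qed

lemma
  assumes p: "p \<in> P" and a: "a \<in> A"
  shows root_letter_inv: "root_letter (inv\<^bsub>B\<^esub> p) (root_letter p a) = a"
    and sec_inv: "sec (root_letter p a) (inv\<^bsub>B\<^esub> p) = inv\<^bsub>B\<^esub> (sec a p)"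
proof -
  have i: "inv\<^bsub>B\<^esub> p \<in> P" using p by (rule P_inv)
  have one: "inv\<^bsub>B\<^esub> p \<otimes>\<^bsub>B\<^esub> p = \<one>\<^bsub>B\<^esub>" using p P_closed by simp
  show "root_letter (inv\<^bsub>B\<^esub> p) (root_letter p a) = a"
    using root_letter_mult[OF i p a] root_letter_one[OF a] one by simp
  have "sec (root_letter p a) (inv\<^bsub>B\<^esub> p) \<otimes>\<^bsub>B\<^esub> sec a p = \<one>\<^bsub>B\<^esub>"
    using sec_mult[OF i p a] sec_one[OF a] one by simp
  then have "inv\<^bsub>B\<^esub> (sec a p) = sec (root_letter p a) (inv\<^bsub>B\<^esub> p)"
    using p a i by (intro B.inv_equality P_closed sec_closed root_letter_closed)
  then show "sec (root_letter p a) (inv\<^bsub>B\<^esub> p) = inv\<^bsub>B\<^esub> (sec a p)" by simp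
qed

text \<open>
  Both exchange conditions are the cocycle identity \<open>sec b (g h) = sec (h b) g \<cdot>
  sec b h\<close> read with \<open>h b = a\<close>, the first for prescribed \<open>sec b
  h\<close> and the second for prescribed \<open>h\<close>.
\<close>

lemma exchanging_maps_P:
  assumes "countable Q" "infinite P"
  shows "exchanging_maps (B\<lparr>carrier := P\<rparr>) D (sec ` A)"
proof (intro exchanging_maps.intro exchanging_maps_axioms.intro; (elim imageE)?; simp?)
  have DP: "D \<subseteq> P" using P_letter by (auto elim: D_E)
  show "group (B\<lparr>carrier := P\<rparr>)" by (rule B.subgroup_imp_group[OF subgroup_P])
  show "countable P" using assms(1) by (rule countable_P)
  show "infinite P" by (rule assms(2))
  have "D = letter ` (Q \<times> UNIV)" unfolding D_def by (rule arg_cong[of _ _ "image letter"]) auto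
  then show "finite D" using finite_Q by simp
  show "D \<subseteq> P" by (rule DP)
  show "inv\<^bsub>B\<lparr>carrier := P\<rparr>\<^esub> d \<in> D" if d: "d \<in> D" for d
  proof -
    obtain x where x: "fst x \<in> Q" "d = letter x" using d by (rule D_E)
    have "inv\<^bsub>B\<lparr>carrier := P\<rparr>\<^esub> d = letter (flip x)"
      using B.m_inv_consistent[OF subgroup_P, of d] d DP x by (auto simp: letter_flip)
    then show ?thesis using x(1) by (simp add: D_I)
  qed
  show "generate (B\<lparr>carrier := P\<rparr>) D = P" by (rule generate_D)
  show "finite (sec ` A)" using finite_A by simp
  show "infinite ((\<lambda>fs. restrict (foldr (\<lambda>f. f) fs) P) ` lists (sec ` A))"
    using finite_sections_imp_finite assms(2) by blast
next
  fix a assume "a \<in> A"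
  then show "bij_betw (sec a) P P" by (rule sec_bij)
next
  fix a assume "a \<in> A"
  then show "sec a \<one>\<^bsub>B\<^esub> = \<one>\<^bsub>B\<^esub>" by (rule sec_one)
next
  fix a d g assume a: "a \<in> A" and d: "d \<in> D" and g: "g \<in> P"
  have dP: "d \<in> P" using d P_letter by (auto elim: D_E)
  have t: "root_letter g a \<in> A" using g a by (rule root_letter_closed)
  show "\<exists>d'\<in>D. sec a (d \<otimes>\<^bsub>B\<^esub> g) = d' \<otimes>\<^bsub>B\<^esub> sec a g"
    using sec_mult[OF dP g a] sec_D[OF d t] by blast
  obtain d' where d': "d' \<in> D" "sec (root_letter g a) d' = d" using d t by (rule sec_D_surj)
  have "d' \<in> P" using d'(1) P_letter by (auto elim: D_E)
  then show "\<exists>d'\<in>D. sec a (d' \<otimes>\<^bsub>B\<^esub> g) = d \<otimes>\<^bsub>B\<^esub> sec a g"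
    using sec_mult[of d' g a] g a d' by blast
next
  fix a k assume a: "a \<in> A" and k: "k \<in> P"
  \<comment> \<open>Since the section of \<open>h\<inverse>\<close> at \<open>root_letter h a\<close> is the inverse of the section of \<open>h\<close> at \<open>a\<close>, a
    preimage of \<open>k\<inverse>\<close> yields the required element as an inverse.\<close>
  obtain h where h: "h \<in> P" "sec a h = inv\<^bsub>B\<^esub> k"
    using sec_bij[OF a] P_inv[OF k] unfolding bij_betw_def by (metis imageE)
  have t: "root_letter h a \<in> A" using h(1) a by (rule root_letter_closed)
  have "sec (root_letter h a) (g \<otimes>\<^bsub>B\<^esub> inv\<^bsub>B\<^esub> h) = sec a g \<otimes>\<^bsub>B\<^esub> k" if g: "g \<in> P" for g
    using sec_mult[OF g P_inv[OF h(1)] t] root_letter_inv[OF h(1) a] sec_inv[OF h(1) a] h(2) P_closed[OF k]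
    by simp
  then show "\<exists>b\<in>A. \<exists>h\<in>P. \<forall>g\<in>P. sec b (g \<otimes>\<^bsub>B\<^esub> h) = sec a g \<otimes>\<^bsub>B\<^esub> k"
    using t P_inv[OF h(1)] by blast
next
  fix a h assume a: "a \<in> A" and h: "h \<in> P"
  let ?b = "root_letter (inv\<^bsub>B\<^esub> h) a"
  have b: "?b \<in> A" using P_inv[OF h] a by (rule root_letter_closed)
  have "root_letter h ?b = a" using root_letter_inv[OF P_inv[OF h] a] P_closed[OF h] by simp
  then have "sec ?b (g \<otimes>\<^bsub>B\<^esub> h) = sec a g \<otimes>\<^bsub>B\<^esub> sec ?b h" if g: "g \<in> P" for g
    using sec_mult[OF g h b] by simp
  then show "\<exists>b\<in>A. \<exists>k\<in>P. \<forall>g\<in>P. sec b (g \<otimes>\<^bsub>B\<^esub> h) = sec a g \<otimes>\<^bsub>B\<^esub> k"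
    using b sec_closed[OF h b] by blast
qed

end

section \<open>Bireversible groups act with a large commensurator\<close>

theorem theorem4p1:
  fixes G :: "('g, 'm) monoid_scheme"
  assumes "group G" and "infinite (carrier G)" and "bireversible_group G"
  shows "\<exists>(X :: (nat, nat) pre_digraph) r \<phi>.
    bidirected_digraph X r \<and> Digraph_Component.connected X \<and> locally_finite X \<and>
    inj_on \<phi> (carrier G) \<and> geometric_action G X r \<phi> \<and>
    (\<exists>x\<in>verts X. \<exists>H.
       fin_gen_subgroup H (graph_Aut X r) \<and>
       H \<subseteq> commensurator (graph_Aut X r) (\<phi> ` carrier G) \<inter> stabilizer (graph_Aut X r) fst x \<and>
       \<not> discrete_subset (Aut_topology X r) H) \<and>
    \<not> compact_by_discrete (graph_Aut X r) (Aut_topology X r)"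
proof -
  obtain M :: "(nat, nat) mealy" where M: "bireversible_automaton M" "G \<cong> mealy_group M"
    using assms(3) unfolding bireversible_group_def by blast
  interpret bireversible M by unfold_locales (rule M(1))
  have iso: "G \<cong> B\<lparr>carrier := P\<rparr>" using M(2) mealy_group_iso by (rule iso_trans)
  then obtain \<psi> where "\<psi> \<in> iso G (B\<lparr>carrier := P\<rparr>)" unfolding is_iso_def by blast
  then have inf: "infinite P"
    using assms(2) bij_betw_finite unfolding iso_def by fastforce
  interpret E: exchanging_maps "B\<lparr>carrier := P\<rparr>" D "sec ` A"
    by (rule exchanging_maps_P[OF _ inf]) simp
  show ?thesis using assms(1) iso by (rule E.cayley_graph_witness)
qed

end
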